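(* There is a Banach space $X$ possessing a closed linear subspace $Y\subset X$ such that $(X,\mathrm{weak})$ is $k$-metrizable, but $(X/Y,\mathrm{weak})$ is not even $\mathrm{cs}^*$-metrizable. Thus none of the properties of $k$-, $k^*$-, $\mathrm{cs}$-, and $\mathrm{cs}^*$-metrizability is preserved by (continuous surjective) open maps.
   Context: $(E,\mathrm{weak})$ denotes a normed space $E$ endowed with its weak topology. All topological spaces are Hausdorff; "map" means continuous function. A subset is precompact if its closure is compact. A map $f:M\to Z$ is proper if $f^{-1}(K)$ is precompact in $M$ for every precompact $K\subset Z$; it is subproper if there is $D\subset M$ with $f(D)=Z$ such that $D\cap f^{-1}(K)$ is precompact in $M$ for every precompact $K\subset Z$. A space is $k$-metrizable (resp. $k^*$-metrizable) if it is the image of a metrizable space under a proper (resp. subproper) map. A section of a map $f:M\to Z$ is a (possibly discontinuous) function $s:Z\to M$ with $f\circ s=\mathrm{id}_Z$. A function $s:Z\to M$ is sequentially continuous if for every convergent sequence $(z_n)$ in $Z$ the sequence $(s(z_n))$ converges in $M$; it is $\mathrm{cs}^*$-continuous if for every convergent sequence $(z_n)$ in $Z$ the sequence $(s(z_n))$ has an accumulation point in $M$ (a point each of whose neighborhoods contains $s(z_n)$ for infinitely many $n$). A space $Z$ is $\mathrm{cs}$-metrizable (resp. $\mathrm{cs}^*$-metrizable) if it is the image of a metrizable space $M$ under a map $\pi:M\to Z$ having a sequentially continuous (resp. $\mathrm{cs}^*$-continuous) section. *)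

theory Defs
  imports "HOL-Analysis.Analysis" "HOL-Algebra.Module" "HOL-Algebra.AbelCoset"
begin

no_notation eq_closure_of (\<open>closure'_of\<index>\<close>)
  \<comment> \<open>clashes with \<open>closure_of\<close> of abstract topologies\<close>

section \<open>Normed spaces, quotients and weak topologies\<close>

text \<open>
  HOL cannot quantify over types inside a formula, so a normed space whose existence is asserted is
  a structure with an explicit carrier. The vector space part is an HOL-Algebra module over the
  field of reals; the multiplicative fields that the module record inherits from the ring record
  play no role.
\<close>

definition real_ring :: "real ring" where
  "real_ring = \<lparr>carrier = UNIV, mult = (*), one = 1, zero = 0, add = (+)\<rparr>"

record 'a normed_module = "(real, 'a) module" +
  vnorm :: "'a \<Rightarrow> real"

text \<open>
  The locale \<open>Metric_space\<close> demands nonnegativity and symmetry of the distance on the whole type,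
  hence the value \<open>0\<close> off the carrier.
\<close>

definition ndist :: "'a normed_module \<Rightarrow> 'a \<Rightarrow> 'a \<Rightarrow> real" where
  "ndist E x y = (if x \<in> carrier E \<and> y \<in> carrier E then vnorm E (x \<ominus>\<^bsub>E\<^esub> y) else 0)"

definition normed_space :: "'a normed_module \<Rightarrow> bool" where
  "normed_space E \<longleftrightarrow>
     module real_ring E \<and>
     (\<forall>x\<in>carrier E. 0 \<le> vnorm E x) \<and>
     (\<forall>x\<in>carrier E. vnorm E x = 0 \<longleftrightarrow> x = \<zero>\<^bsub>E\<^esub>) \<and>
     (\<forall>c. \<forall>x\<in>carrier E. vnorm E (c \<odot>\<^bsub>E\<^esub> x) = \<bar>c\<bar> * vnorm E x) \<and>
     (\<forall>x\<in>carrier E. \<forall>y\<in>carrier E. vnorm E (x \<oplus>\<^bsub>E\<^esub> y) \<le> vnorm E x + vnorm E y)"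

definition banach_space :: "'a normed_module \<Rightarrow> bool" where
  "banach_space E \<longleftrightarrow> normed_space E \<and> Metric_space.mcomplete (carrier E) (ndist E)"

definition norm_topology :: "'a normed_module \<Rightarrow> 'a topology" where
  "norm_topology E = Metric_space.mtopology (carrier E) (ndist E)"

definition closed_linear_subspace :: "'a set \<Rightarrow> 'a normed_module \<Rightarrow> bool" where
  "closed_linear_subspace Y E \<longleftrightarrow> submodule Y real_ring E \<and> closedin (norm_topology E) Y"

text \<open>
  Scalar multiplication of cosets is written as a union (as the library does for products of cosets
  of ideals), because the plain image of a coset under multiplication by \<open>0\<close> is not a coset.
\<close>

definition quotient_space :: "'a normed_module \<Rightarrow> 'a set \<Rightarrow> 'a set normed_module" where
  "quotient_space E Y =
     \<lparr>carrier = a_rcosets\<^bsub>E\<^esub> Y, mult = undefined, one = undefined,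
      zero = Y, add = set_add E,
      smult = (\<lambda>c A. \<Union>a\<in>A. Y +>\<^bsub>E\<^esub> (c \<odot>\<^bsub>E\<^esub> a)),
      vnorm = (\<lambda>A. INF a\<in>A. vnorm E a)\<rparr>"

definition continuous_dual :: "'a normed_module \<Rightarrow> ('a \<Rightarrow> real) set" where
  "continuous_dual E =
     {\<phi>. (\<forall>x\<in>carrier E. \<forall>y\<in>carrier E. \<phi> (x \<oplus>\<^bsub>E\<^esub> y) = \<phi> x + \<phi> y) \<and>
         (\<forall>c. \<forall>x\<in>carrier E. \<phi> (c \<odot>\<^bsub>E\<^esub> x) = c * \<phi> x) \<and>
         continuous_map (norm_topology E) euclideanreal \<phi>}"

definition weak_topology :: "'a normed_module \<Rightarrow> 'a topology" where
  "weak_topology E =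
     topology_generated_by {{x \<in> carrier E. \<phi> x \<in> U} | \<phi> U. \<phi> \<in> continuous_dual E \<and> open U}"


section \<open>Proper and subproper maps, generalized metrizability\<close>

definition precompactin :: "'a topology \<Rightarrow> 'a set \<Rightarrow> bool" where
  "precompactin Z K \<longleftrightarrow> K \<subseteq> topspace Z \<and> compactin Z (Z closure_of K)"

text \<open>
  Proper in the sense of preimages of precompact sets. The library's \<open>proper_map\<close> (closed with
  compact fibres) is a different notion.
\<close>

definition k_proper_map :: "'m topology \<Rightarrow> 'z topology \<Rightarrow> ('m \<Rightarrow> 'z) \<Rightarrow> bool" where
  "k_proper_map M Z f \<longleftrightarrow>
     continuous_map M Z f \<and>
     (\<forall>K. precompactin Z K \<longrightarrow> precompactin M {x \<in> topspace M. f x \<in> K})"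

definition subproper_map :: "'m topology \<Rightarrow> 'z topology \<Rightarrow> ('m \<Rightarrow> 'z) \<Rightarrow> bool" where
  "subproper_map M Z f \<longleftrightarrow>
     continuous_map M Z f \<and>
     (\<exists>D \<subseteq> topspace M. f ` D = topspace Z \<and>
        (\<forall>K. precompactin Z K \<longrightarrow> precompactin M {x \<in> D. f x \<in> K}))"

definition section_of :: "'m topology \<Rightarrow> 'z topology \<Rightarrow> ('m \<Rightarrow> 'z) \<Rightarrow> ('z \<Rightarrow> 'm) \<Rightarrow> bool" where
  "section_of M Z f s \<longleftrightarrow> s \<in> topspace Z \<rightarrow> topspace M \<and> (\<forall>z\<in>topspace Z. f (s z) = z)"

definition convergentin :: "'a topology \<Rightarrow> (nat \<Rightarrow> 'a) \<Rightarrow> bool" where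
  "convergentin Z z \<longleftrightarrow> range z \<subseteq> topspace Z \<and> (\<exists>l. limitin Z z l sequentially)"

definition accumulation_point :: "'a topology \<Rightarrow> (nat \<Rightarrow> 'a) \<Rightarrow> 'a \<Rightarrow> bool" where
  "accumulation_point M x p \<longleftrightarrow>
     p \<in> topspace M \<and> (\<forall>U. openin M U \<and> p \<in> U \<longrightarrow> infinite {n. x n \<in> U})"

definition seq_continuous :: "'z topology \<Rightarrow> 'm topology \<Rightarrow> ('z \<Rightarrow> 'm) \<Rightarrow> bool" where
  "seq_continuous Z M s \<longleftrightarrow> (\<forall>z. convergentin Z z \<longrightarrow> convergentin M (s \<circ> z))"

definition cs_star_continuous :: "'z topology \<Rightarrow> 'm topology \<Rightarrow> ('z \<Rightarrow> 'm) \<Rightarrow> bool" where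
  "cs_star_continuous Z M s \<longleftrightarrow>
     (\<forall>z. convergentin Z z \<longrightarrow> (\<exists>p. accumulation_point M (s \<circ> z) p))"

text \<open>
  In the four definitions below, the metrizable space \<open>M\<close> lives on the type \<open>nat \<Rightarrow> 'z\<close>, where \<open>'z\<close>
  is the point type of \<open>Z\<close>. This loses nothing: \<open>k_metrizableI\<close>, \<open>k_star_metrizableI\<close>,
  \<open>cs_metrizableI\<close> and \<open>cs_star_metrizableI\<close> at the end of this theory show that a witness on an
  arbitrary type can be replaced by one on \<open>nat \<Rightarrow> 'z\<close>, namely a copy of the closure of the image of
  a section (every point of which is the limit of a sequence of values of the section).
  The Hausdorff property of \<open>Z\<close> is not part of these predicates.
\<close>

definition k_metrizable :: "'z topology \<Rightarrow> bool" where
  "k_metrizable Z \<longleftrightarrow>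
     (\<exists>(M :: (nat \<Rightarrow> 'z) topology) f.
        metrizable_space M \<and> k_proper_map M Z f \<and> f ` topspace M = topspace Z)"

definition k_star_metrizable :: "'z topology \<Rightarrow> bool" where
  "k_star_metrizable Z \<longleftrightarrow>
     (\<exists>(M :: (nat \<Rightarrow> 'z) topology) f.
        metrizable_space M \<and> subproper_map M Z f \<and> f ` topspace M = topspace Z)"

definition cs_metrizable :: "'z topology \<Rightarrow> bool" where
  "cs_metrizable Z \<longleftrightarrow>
     (\<exists>(M :: (nat \<Rightarrow> 'z) topology) f s.
        metrizable_space M \<and> continuous_map M Z f \<and> f ` topspace M = topspace Z \<and>
        section_of M Z f s \<and> seq_continuous Z M s)"

definition cs_star_metrizable :: "'z topology \<Rightarrow> bool" where
  "cs_star_metrizable Z \<longleftrightarrow>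
     (\<exists>(M :: (nat \<Rightarrow> 'z) topology) f s.
        metrizable_space M \<and> continuous_map M Z f \<and> f ` topspace M = topspace Z \<and>
        section_of M Z f s \<and> cs_star_continuous Z M s)"

text \<open>
  \<open>P\<close> and \<open>Q\<close> are meant to be the same topological property, at the two point types.
\<close>

definition preserved_by_open_maps ::
    "('a topology \<Rightarrow> bool) \<Rightarrow> ('b topology \<Rightarrow> bool) \<Rightarrow> bool" where
  "preserved_by_open_maps P Q \<longleftrightarrow>
     (\<forall>Z W q. Hausdorff_space Z \<and> Hausdorff_space W \<and> continuous_map Z W q \<and> open_map Z W q \<and>
        q ` topspace Z = topspace W \<and> P Z \<longrightarrow> Q W)"


section \<open>The distance is a metric and the quotient norm is a norm\<close>

lemma vnorm_uminus:
  assumes "normed_space E" and x: "x \<in> carrier E"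
  shows "vnorm E (\<ominus>\<^bsub>E\<^esub> x) = vnorm E x"
proof -
  interpret module real_ring E using assms unfolding normed_space_def by blast
  have "(-1) \<odot>\<^bsub>E\<^esub> x \<oplus>\<^bsub>E\<^esub> 1 \<odot>\<^bsub>E\<^esub> x = \<zero>\<^bsub>E\<^esub>"
    using smult_l_distr[of "-1" 1 x] smult_l_null[OF x] x by (simp add: real_ring_def)
  then have "\<ominus>\<^bsub>E\<^esub> x = (-1) \<odot>\<^bsub>E\<^esub> x"
    using smult_one[OF x] smult_closed[of "-1" x] x M.minus_equality
    by (simp add: real_ring_def)
  then show ?thesis using assms unfolding normed_space_def by simp
qed

lemma Metric_space_ndist:
  assumes "normed_space E"
  shows "Metric_space (carrier E) (ndist E)"
proof -
  interpret module real_ring E using assms unfolding normed_space_def by blast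
  show ?thesis
  proof
    fix x y
    show "0 \<le> ndist E x y"
      using assms unfolding normed_space_def ndist_def by simp
  next
    fix x y
    have "vnorm E (x \<ominus>\<^bsub>E\<^esub> y) = vnorm E (y \<ominus>\<^bsub>E\<^esub> x)"
      if "x \<in> carrier E" "y \<in> carrier E"
    proof -
      have "\<ominus>\<^bsub>E\<^esub> (x \<ominus>\<^bsub>E\<^esub> y) = y \<ominus>\<^bsub>E\<^esub> x"
        using that by (simp add: a_minus_def M.minus_add M.a_comm)
      then show ?thesis using vnorm_uminus[OF assms, of "x \<ominus>\<^bsub>E\<^esub> y"] that by simp
    qed
    then show "ndist E x y = ndist E y x"
      unfolding ndist_def by auto
  next
    fix x y assume xy: "x \<in> carrier E" "y \<in> carrier E"
    have "x \<ominus>\<^bsub>E\<^esub> y = \<zero>\<^bsub>E\<^esub> \<longleftrightarrow> x = y"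
      using xy by (metis M.minus_equality M.minus_minus M.r_neg M.a_inv_closed a_minus_def)
    then show "ndist E x y = 0 \<longleftrightarrow> x = y"
      using assms xy unfolding normed_space_def ndist_def by simp
  next
    fix x y z assume xyz: "x \<in> carrier E" "y \<in> carrier E" "z \<in> carrier E"
    then have "x \<ominus>\<^bsub>E\<^esub> z = (x \<ominus>\<^bsub>E\<^esub> y) \<oplus>\<^bsub>E\<^esub> (y \<ominus>\<^bsub>E\<^esub> z)"
      by (simp add: a_minus_def M.a_assoc M.r_neg1)
    then show "ndist E x z \<le> ndist E x y + ndist E y z"
      using assms xyz unfolding normed_space_def ndist_def by simp
  qed
qed

theorem normed_space_quotient_space:
  assumes E: "normed_space E" and Y: "closed_linear_subspace Y E"
  shows "normed_space (quotient_space E Y)"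
proof -
  interpret module real_ring E using E unfolding normed_space_def by blast
  have sub: "submodule Y real_ring E" using Y unfolding closed_linear_subspace_def by blast
  have YE: "Y \<subseteq> carrier E" by (rule submoduleE(1)[OF sub])
  interpret S: abelian_subgroup Y E
    using abelian_subgroupI2 submodule.axioms(1)[OF sub] M.a_comm_group by blast
  let ?Q = "quotient_space E Y"
  have Qsel: "carrier ?Q = a_rcosets\<^bsub>E\<^esub> Y" "add ?Q = set_add E" "zero ?Q = Y"
    "smult ?Q = (\<lambda>c A. \<Union>a\<in>A. Y +>\<^bsub>E\<^esub> (c \<odot>\<^bsub>E\<^esub> a))" "vnorm ?Q = (\<lambda>A. INF a\<in>A. vnorm E a)"
    unfolding quotient_space_def by simp_all
  have cosets: "A \<in> carrier ?Q \<longleftrightarrow> (\<exists>a\<in>carrier E. A = Y +>\<^bsub>E\<^esub> a)" for A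
    unfolding Qsel A_RCOSETS_def' by auto
  have self: "a \<in> Y +>\<^bsub>E\<^esub> a" if "a \<in> carrier E" for a
    by (rule S.a_rcos_self[OF that])
  have cosE: "Y +>\<^bsub>E\<^esub> a \<subseteq> carrier E" if "a \<in> carrier E" for a
    by (rule M.a_r_coset_subset_G[OF YE that])
  have smul: "c \<odot>\<^bsub>?Q\<^esub> (Y +>\<^bsub>E\<^esub> a) = Y +>\<^bsub>E\<^esub> (c \<odot>\<^bsub>E\<^esub> a)" if a: "a \<in> carrier E" for c a
  proof -
    have ca: "c \<odot>\<^bsub>E\<^esub> a \<in> carrier E" using a by (simp add: real_ring_def)
    have "Y +>\<^bsub>E\<^esub> (c \<odot>\<^bsub>E\<^esub> b) = Y +>\<^bsub>E\<^esub> (c \<odot>\<^bsub>E\<^esub> a)" if b: "b \<in> Y +>\<^bsub>E\<^esub> a" for b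
    proof -
      obtain y where y: "y \<in> Y" "b = y \<oplus>\<^bsub>E\<^esub> a" using b unfolding a_r_coset_def' by auto
      have "c \<odot>\<^bsub>E\<^esub> b = (c \<odot>\<^bsub>E\<^esub> y) \<oplus>\<^bsub>E\<^esub> (c \<odot>\<^bsub>E\<^esub> a)"
        using y a YE smult_r_distr[of c y a] by (auto simp: real_ring_def)
      moreover have "c \<odot>\<^bsub>E\<^esub> y \<in> Y"
        using submoduleE(4)[OF sub, of c y] y by (simp add: real_ring_def)
      ultimately have "c \<odot>\<^bsub>E\<^esub> b \<in> Y +>\<^bsub>E\<^esub> (c \<odot>\<^bsub>E\<^esub> a)" unfolding a_r_coset_def' by auto
      then show ?thesis
        using M.a_repr_independence[OF _ ca submodule.axioms(1)[OF sub]] by blast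
    qed
    then show ?thesis unfolding Qsel(4) by (intro UN_constant_eq[OF self[OF a]]) blast
  qed
  have plus: "(Y +>\<^bsub>E\<^esub> a) \<oplus>\<^bsub>?Q\<^esub> (Y +>\<^bsub>E\<^esub> b) = Y +>\<^bsub>E\<^esub> (a \<oplus>\<^bsub>E\<^esub> b)"
    if "a \<in> carrier E" "b \<in> carrier E" for a b
    unfolding Qsel using S.a_rcos_sum[OF that] .
  have Y0: "Y +>\<^bsub>E\<^esub> \<zero>\<^bsub>E\<^esub> = Y"
    using M.a_coset_join2[OF _ submodule.axioms(1)[OF sub]] by simp
  have grp: "abelian_group ?Q"
  proof (rule abelian_groupI)
    show "\<zero>\<^bsub>?Q\<^esub> \<in> carrier ?Q"
      by (rule cosets[THEN iffD2]) (use Y0 Qsel(3) M.zero_closed in metis)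
  next
    fix x y z assume "x \<in> carrier ?Q" "y \<in> carrier ?Q" "z \<in> carrier ?Q"
    then obtain u v w where uvw: "u \<in> carrier E" "v \<in> carrier E" "w \<in> carrier E"
      and xyz: "x = Y +>\<^bsub>E\<^esub> u" "y = Y +>\<^bsub>E\<^esub> v" "z = Y +>\<^bsub>E\<^esub> w"
      using cosets[THEN iffD1] by metis
    show "x \<oplus>\<^bsub>?Q\<^esub> y \<oplus>\<^bsub>?Q\<^esub> z = x \<oplus>\<^bsub>?Q\<^esub> (y \<oplus>\<^bsub>?Q\<^esub> z)"
      using uvw by (simp add: xyz plus M.a_assoc)
  next
    fix x y assume "x \<in> carrier ?Q" "y \<in> carrier ?Q"
    then obtain u v where uv: "u \<in> carrier E" "v \<in> carrier E"
      and xy: "x = Y +>\<^bsub>E\<^esub> u" "y = Y +>\<^bsub>E\<^esub> v"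
      using cosets[THEN iffD1] by metis
    show "x \<oplus>\<^bsub>?Q\<^esub> y = y \<oplus>\<^bsub>?Q\<^esub> x"
      using uv by (simp add: xy plus M.a_comm)
    show "x \<oplus>\<^bsub>?Q\<^esub> y \<in> carrier ?Q"
      unfolding xy plus[OF uv] by (rule cosets[THEN iffD2]) (use M.a_closed[OF uv] in blast)
  next
    fix x assume "x \<in> carrier ?Q"
    then obtain u where u: "u \<in> carrier E" and x: "x = Y +>\<^bsub>E\<^esub> u"
      using cosets[THEN iffD1] by metis
    have z: "\<zero>\<^bsub>?Q\<^esub> = Y +>\<^bsub>E\<^esub> \<zero>\<^bsub>E\<^esub>" unfolding Y0 Qsel(3) ..
    show "\<zero>\<^bsub>?Q\<^esub> \<oplus>\<^bsub>?Q\<^esub> x = x"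
      unfolding x z plus[OF M.zero_closed u] using u by simp
    have "Y +>\<^bsub>E\<^esub> (\<ominus>\<^bsub>E\<^esub> u) \<in> carrier ?Q"
      by (rule cosets[THEN iffD2]) (use M.a_inv_closed[OF u] in blast)
    moreover have "(Y +>\<^bsub>E\<^esub> (\<ominus>\<^bsub>E\<^esub> u)) \<oplus>\<^bsub>?Q\<^esub> x = \<zero>\<^bsub>?Q\<^esub>"
      unfolding x z plus[OF M.a_inv_closed[OF u] u] M.l_neg[OF u] ..
    ultimately show "\<exists>y\<in>carrier ?Q. y \<oplus>\<^bsub>?Q\<^esub> x = \<zero>\<^bsub>?Q\<^esub>" by blast
  qed
  have mod: "module real_ring ?Q"
  proof (rule moduleI)
    show "cring real_ring" by (rule R.is_cring)
    show "abelian_group ?Q" by (rule grp)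
  next
    fix a b :: real and x y
    assume "x \<in> carrier ?Q" "y \<in> carrier ?Q"
    then obtain u v where u: "u \<in> carrier E" "x = Y +>\<^bsub>E\<^esub> u" and v: "v \<in> carrier E" "y = Y +>\<^bsub>E\<^esub> v"
      using cosets[THEN iffD1] by metis
    have cl: "c \<odot>\<^bsub>E\<^esub> u \<in> carrier E" "c \<odot>\<^bsub>E\<^esub> v \<in> carrier E" for c
      using u v by (simp_all add: real_ring_def)
    show "a \<odot>\<^bsub>?Q\<^esub> x \<in> carrier ?Q"
      unfolding u smul[OF u(1)] by (rule cosets[THEN iffD2]) (use cl in blast)
    show "a \<odot>\<^bsub>?Q\<^esub> (x \<oplus>\<^bsub>?Q\<^esub> y) = a \<odot>\<^bsub>?Q\<^esub> x \<oplus>\<^bsub>?Q\<^esub> a \<odot>\<^bsub>?Q\<^esub> y"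
      using u v cl smult_r_distr[of a u v] by (simp add: plus smul real_ring_def)
    show "(a \<oplus>\<^bsub>real_ring\<^esub> b) \<odot>\<^bsub>?Q\<^esub> x = a \<odot>\<^bsub>?Q\<^esub> x \<oplus>\<^bsub>?Q\<^esub> b \<odot>\<^bsub>?Q\<^esub> x"
      using u cl smult_l_distr[of a b u] by (simp add: plus smul real_ring_def)
    show "(a \<otimes>\<^bsub>real_ring\<^esub> b) \<odot>\<^bsub>?Q\<^esub> x = a \<odot>\<^bsub>?Q\<^esub> (b \<odot>\<^bsub>?Q\<^esub> x)"
      using u cl smult_assoc1[of a b u] by (simp add: smul real_ring_def)
    show "\<one>\<^bsub>real_ring\<^esub> \<odot>\<^bsub>?Q\<^esub> x = x"
      using u smult_one[of u] by (simp add: smul)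
  qed
  have nn: "0 \<le> vnorm E a" if "a \<in> carrier E" for a
    using E that unfolding normed_space_def by blast
  have bdd: "bdd_below (vnorm E ` (Y +>\<^bsub>E\<^esub> a))" if "a \<in> carrier E" for a
    using nn cosE[OF that] by (intro bdd_belowI[of _ 0]) auto
  have low: "vnorm ?Q (Y +>\<^bsub>E\<^esub> a) \<le> vnorm E b"
    if "a \<in> carrier E" "b \<in> Y +>\<^bsub>E\<^esub> a" for a b
    unfolding Qsel by (rule cINF_lower[OF bdd[OF that(1)] that(2)])
  have near: "\<exists>b\<in>Y +>\<^bsub>E\<^esub> a. vnorm E b < r"
    if "a \<in> carrier E" "vnorm ?Q (Y +>\<^bsub>E\<^esub> a) < r" for a r
    using that(2) cINF_less_iff[OF _ bdd[OF that(1)], of r] self[OF that(1)] unfolding Qsel by blast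
  have Qnn: "0 \<le> vnorm ?Q (Y +>\<^bsub>E\<^esub> a)" if "a \<in> carrier E" for a
    unfolding Qsel by (rule cINF_greatest) (use self[OF that] cosE[OF that] nn in auto)
  have same: "Y +>\<^bsub>E\<^esub> b = Y +>\<^bsub>E\<^esub> a" if "a \<in> carrier E" "b \<in> Y +>\<^bsub>E\<^esub> a" for a b
    using M.a_repr_independence[OF that(2,1) submodule.axioms(1)[OF sub]] by simp
  have Qle: "vnorm ?Q (Y +>\<^bsub>E\<^esub> (c \<odot>\<^bsub>E\<^esub> a)) \<le> \<bar>c\<bar> * vnorm ?Q (Y +>\<^bsub>E\<^esub> a)"
    if a: "a \<in> carrier E" for c a
  proof (rule field_le_epsilon)
    fix \<epsilon> :: real assume \<epsilon>: "0 < \<epsilon>"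
    define \<delta> where "\<delta> = \<epsilon> / (\<bar>c\<bar> + 1)"
    have \<delta>: "0 < \<delta>" "\<bar>c\<bar> * \<delta> \<le> \<epsilon>" using \<epsilon> unfolding \<delta>_def by (auto simp: field_simps)
    obtain b where b: "b \<in> Y +>\<^bsub>E\<^esub> a" "vnorm E b < vnorm ?Q (Y +>\<^bsub>E\<^esub> a) + \<delta>"
      using near[OF a, of "vnorm ?Q (Y +>\<^bsub>E\<^esub> a) + \<delta>"] \<delta> by auto
    have bE: "b \<in> carrier E" using b cosE[OF a] by blast
    then have cb: "c \<odot>\<^bsub>E\<^esub> b \<in> carrier E" by (simp add: real_ring_def)
    have "Y +>\<^bsub>E\<^esub> (c \<odot>\<^bsub>E\<^esub> b) = Y +>\<^bsub>E\<^esub> (c \<odot>\<^bsub>E\<^esub> a)"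
      using smul[OF a, of c] smul[OF bE, of c] same[OF a b(1)] by simp
    then have "vnorm ?Q (Y +>\<^bsub>E\<^esub> (c \<odot>\<^bsub>E\<^esub> a)) \<le> vnorm E (c \<odot>\<^bsub>E\<^esub> b)"
      using low[OF cb self[OF cb]] by simp
    also have "\<dots> = \<bar>c\<bar> * vnorm E b" using E bE unfolding normed_space_def by blast
    also have "\<dots> \<le> \<bar>c\<bar> * (vnorm ?Q (Y +>\<^bsub>E\<^esub> a) + \<delta>)"
      using b(2) by (intro mult_left_mono) auto
    also have "\<dots> \<le> \<bar>c\<bar> * vnorm ?Q (Y +>\<^bsub>E\<^esub> a) + \<epsilon>"
      using \<delta> by (simp add: distrib_left)
    finally show "vnorm ?Q (Y +>\<^bsub>E\<^esub> (c \<odot>\<^bsub>E\<^esub> a)) \<le> \<bar>c\<bar> * vnorm ?Q (Y +>\<^bsub>E\<^esub> a) + \<epsilon>" .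
  qed
  have zer: "Y +>\<^bsub>E\<^esub> a = Y" if a: "a \<in> carrier E" and z: "vnorm ?Q (Y +>\<^bsub>E\<^esub> a) = 0" for a
  proof -
    interpret N: Metric_space "carrier E" "ndist E" by (rule Metric_space_ndist[OF E])
    have "a \<in> Y"
    proof (rule ccontr)
      assume "a \<notin> Y"
      have "openin N.mtopology (carrier E - Y)"
        using Y unfolding closed_linear_subspace_def norm_topology_def closedin_def by simp
      then obtain r where r: "r > 0" "N.mball a r \<subseteq> carrier E - Y"
        using a \<open>a \<notin> Y\<close> unfolding N.openin_mtopology by blast
      obtain b where b: "b \<in> Y +>\<^bsub>E\<^esub> a" "vnorm E b < r" using near[OF a, of r] z r by auto
      obtain y where y: "y \<in> Y" "b = y \<oplus>\<^bsub>E\<^esub> a" using b unfolding a_r_coset_def' by auto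
      have yE: "y \<in> carrier E" using y YE by blast
      have my: "\<ominus>\<^bsub>E\<^esub> y \<in> Y" using submoduleE(3)[OF sub] y by blast
      have "a \<ominus>\<^bsub>E\<^esub> (\<ominus>\<^bsub>E\<^esub> y) = b" using a yE y by (simp add: a_minus_def M.a_comm)
      then have "\<ominus>\<^bsub>E\<^esub> y \<in> N.mball a r"
        using a yE b unfolding N.in_mball ndist_def by simp
      then show False using r my by blast
    qed
    then show ?thesis using M.a_coset_join2[OF a submodule.axioms(1)[OF sub]] by blast
  qed
  show ?thesis
    unfolding normed_space_def
  proof (intro conjI ballI allI)
    show "module real_ring ?Q" by (rule mod)
  next
    fix A assume "A \<in> carrier ?Q"
    then obtain a where a: "a \<in> carrier E" and A: "A = Y +>\<^bsub>E\<^esub> a"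
      using cosets[THEN iffD1] by metis
    show "0 \<le> vnorm ?Q A" unfolding A by (rule Qnn[OF a])
    have "vnorm ?Q Y = 0"
    proof (rule antisym)
      have "vnorm E \<zero>\<^bsub>E\<^esub> = 0" using E unfolding normed_space_def by simp
      then show "vnorm ?Q Y \<le> 0" using low[OF _ self, of "\<zero>\<^bsub>E\<^esub>"] unfolding Y0 by simp
      show "0 \<le> vnorm ?Q Y" using Qnn[of "\<zero>\<^bsub>E\<^esub>"] unfolding Y0 by simp
    qed
    then show "vnorm ?Q A = 0 \<longleftrightarrow> A = \<zero>\<^bsub>?Q\<^esub>"
      using zer[OF a] A unfolding Qsel(3) by auto
    show "vnorm ?Q (c \<odot>\<^bsub>?Q\<^esub> A) = \<bar>c\<bar> * vnorm ?Q A" for c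
    proof (cases "c = 0")
      case True
      have "0 \<odot>\<^bsub>E\<^esub> a = \<zero>\<^bsub>E\<^esub>" using smult_l_null[OF a] by (simp add: real_ring_def)
      then show ?thesis using True \<open>vnorm ?Q Y = 0\<close> unfolding A smul[OF a] by (simp add: Y0)
    next
      case False
      have ca: "c \<odot>\<^bsub>E\<^esub> a \<in> carrier E" using a by (simp add: real_ring_def)
      have "inverse c \<odot>\<^bsub>E\<^esub> (c \<odot>\<^bsub>E\<^esub> a) = a"
        using smult_assoc1[of "inverse c" c a] smult_one[OF a] a False by (simp add: real_ring_def)
      then have "vnorm ?Q A \<le> \<bar>inverse c\<bar> * vnorm ?Q (Y +>\<^bsub>E\<^esub> (c \<odot>\<^bsub>E\<^esub> a))"
        using Qle[OF ca, of "inverse c"] A by simp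
      then have "\<bar>c\<bar> * vnorm ?Q A \<le> vnorm ?Q (Y +>\<^bsub>E\<^esub> (c \<odot>\<^bsub>E\<^esub> a))"
        using False by (simp add: field_simps abs_inverse)
      then show ?thesis using Qle[OF a, of c] unfolding A smul[OF a] by simp
    qed
    fix B assume "B \<in> carrier ?Q"
    then obtain b where b: "b \<in> carrier E" and B: "B = Y +>\<^bsub>E\<^esub> b"
      using cosets[THEN iffD1] by metis
    show "vnorm ?Q (A \<oplus>\<^bsub>?Q\<^esub> B) \<le> vnorm ?Q A + vnorm ?Q B"
    proof (rule field_le_epsilon)
      fix \<epsilon> :: real assume \<epsilon>: "0 < \<epsilon>"
      obtain u where u: "u \<in> A" "vnorm E u < vnorm ?Q A + \<epsilon> / 2"
        using near[OF a, of "vnorm ?Q A + \<epsilon> / 2"] \<epsilon> A by auto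
      obtain v where v: "v \<in> B" "vnorm E v < vnorm ?Q B + \<epsilon> / 2"
        using near[OF b, of "vnorm ?Q B + \<epsilon> / 2"] \<epsilon> B by auto
      have uv: "u \<in> carrier E" "v \<in> carrier E" using u v cosE[OF a] cosE[OF b] unfolding A B by auto
      have "A \<oplus>\<^bsub>?Q\<^esub> B = Y +>\<^bsub>E\<^esub> (u \<oplus>\<^bsub>E\<^esub> v)"
        using plus[OF uv] same[OF a, of u] same[OF b, of v] u v A B by simp
      then have "vnorm ?Q (A \<oplus>\<^bsub>?Q\<^esub> B) \<le> vnorm E (u \<oplus>\<^bsub>E\<^esub> v)"
        using low[OF _ self, of "u \<oplus>\<^bsub>E\<^esub> v"] uv by simp
      also have "\<dots> \<le> vnorm E u + vnorm E v"
        using E uv unfolding normed_space_def by blast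
      finally show "vnorm ?Q (A \<oplus>\<^bsub>?Q\<^esub> B) \<le> vnorm ?Q A + vnorm ?Q B + \<epsilon>"
        using u v by simp
    qed
  qed
qed


section \<open>The four notions do not depend on the type of the metrizable space\<close>

lemma metrizable_copy:
  fixes M :: "'m topology" and s :: "'z \<Rightarrow> 'm" and A :: "'z set"
  assumes M: "metrizable_space M" and s: "s \<in> A \<rightarrow> topspace M"
  obtains M' :: "(nat \<Rightarrow> 'z) topology" and e g where
    "metrizable_space M'"
    "homeomorphic_maps (subtopology M (M closure_of (s ` A))) M' e g"
proof -
  define C where "C = M closure_of (s ` A)"
  have CM: "C \<subseteq> topspace M"
    unfolding C_def by (rule closure_of_subset_topspace)
  obtain S d where Md: "Metric_space S d" "M = Metric_space.mtopology S d"
    using M unfolding metrizable_space_def by blast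
  interpret Metric_space S d by (rule Md(1))
  have ex: "\<exists>z. range z \<subseteq> A \<and> limitin M (s \<circ> z) c sequentially" if "c \<in> C" for c
  proof -
    have "c \<in> mtopology closure_of (s ` A)"
      using that unfolding C_def Md(2) .
    then obtain \<sigma> where \<sigma>: "range \<sigma> \<subseteq> s ` A \<inter> S" "limitin M \<sigma> c sequentially"
      using closure_of_sequentially[of "s ` A"] Md(2) by auto
    have "\<forall>n. \<exists>z. z \<in> A \<and> s z = \<sigma> n"
      using \<sigma>(1) by (auto simp: subset_iff image_iff) metis
    then obtain z where z: "\<And>n. z n \<in> A \<and> s (z n) = \<sigma> n" by metis
    then have "s \<circ> z = \<sigma>" by auto
    then show ?thesis using z \<sigma>(2) by (intro exI[of _ z]) auto
  qed
  define e where "e c = (SOME z. range z \<subseteq> A \<and> limitin M (s \<circ> z) c sequentially)" for c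
  have e: "limitin M (s \<circ> e c) c sequentially" if "c \<in> C" for c
    unfolding e_def using someI_ex[OF ex[OF that]] by blast
  have haus: "Hausdorff_space M"
    by (rule metrizable_imp_Hausdorff_space[OF M])
  have inj: "inj_on e C"
  proof (rule inj_onI)
    fix a b assume "a \<in> C" "b \<in> C" "e a = e b"
    then show "a = b"
      using e[of a] e[of b] limitin_Hausdorff_unique[OF _ _ _ haus] trivial_limit_sequentially
      by metis
  qed
  define g where "g = inv_into C e"
  have ge: "g (e c) = c" if "c \<in> C" for c
    unfolding g_def using inj that by simp
  define M' where "M' = pullback_topology (e ` C) g (subtopology M C)"
  have top: "topspace M' = e ` C"
    unfolding M'_def topspace_pullback_topology using CM ge by auto
  have cg: "continuous_map M' (subtopology M C) g"
    using continuous_map_pullback[OF continuous_map_id, of "e ` C" g "subtopology M C"]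
    unfolding M'_def by simp
  have ce: "continuous_map (subtopology M C) M' e"
    unfolding M'_def
  proof (rule continuous_map_pullback')
    have "continuous_map (subtopology M C) (subtopology M C) id" by simp
    then show "continuous_map (subtopology M C) (subtopology M C) (g \<circ> e)"
      by (rule continuous_map_eq) (use ge in auto)
    show "topspace (subtopology M C) \<subseteq> e -` (e ` C)" by auto
  qed
  have hom: "homeomorphic_maps (subtopology M C) M' e g"
    unfolding homeomorphic_maps_def using ce cg top ge by auto
  moreover have "metrizable_space M'"
    using hom M metrizable_space_subtopology homeomorphic_metrizable_space
      homeomorphic_maps_imp_homeomorphic_space by blast
  ultimately show ?thesis using that unfolding C_def by blast
qed

locale metrizable_transfer =
  fixes M :: "'m topology" and Z :: "'z topology" and f s
    and M' :: "(nat \<Rightarrow> 'z) topology" and e g C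
  assumes M: "metrizable_space M" and f: "continuous_map M Z f" and s: "section_of M Z f s"
    and C: "C = M closure_of (s ` topspace Z)"
    and M': "metrizable_space M'" and hom: "homeomorphic_maps (subtopology M C) M' e g"
begin

lemma CM: "C \<subseteq> topspace M"
  unfolding C by (rule closure_of_subset_topspace)

lemma sC: "z \<in> topspace Z \<Longrightarrow> s z \<in> C"
  using s closure_of_subset[of "s ` topspace Z" M] unfolding C section_of_def by blast

lemma ge: "c \<in> C \<Longrightarrow> g (e c) = c" and eg: "m \<in> topspace M' \<Longrightarrow> e (g m) = m"
  using hom CM unfolding homeomorphic_maps_def by auto

lemma eC: "c \<in> C \<Longrightarrow> e c \<in> topspace M'" and gC: "m \<in> topspace M' \<Longrightarrow> g m \<in> C"
  using hom CM unfolding homeomorphic_maps_def continuous_map_def by auto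

lemma ce: "continuous_map (subtopology M C) M' e"
  using hom unfolding homeomorphic_maps_def by blast

lemma cg: "continuous_map M' M g"
  using hom unfolding homeomorphic_maps_def continuous_map_in_subtopology by blast

lemma cont: "continuous_map M' Z (f \<circ> g)"
  by (rule continuous_map_compose[OF cg f])

lemma sec: "section_of M' Z (f \<circ> g) (e \<circ> s)"
  using s sC eC ge unfolding section_of_def by auto

lemma surj: "(f \<circ> g) ` topspace M' = topspace Z"
proof (rule antisym)
  show "(f \<circ> g) ` topspace M' \<subseteq> topspace Z"
    using cont by (rule continuous_map_image_subset_topspace)
  show "topspace Z \<subseteq> (f \<circ> g) ` topspace M'"
  proof
    fix z assume "z \<in> topspace Z"
    then have "(e \<circ> s) z \<in> topspace M'" "(f \<circ> g) ((e \<circ> s) z) = z"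
      using sec unfolding section_of_def by auto
    then show "z \<in> (f \<circ> g) ` topspace M'" by (metis imageI)
  qed
qed

lemma precompact:
  assumes A: "precompactin M A" and B: "B \<subseteq> topspace M'" "g ` B \<subseteq> A"
  shows "precompactin M' B"
proof -
  define K where "K = M closure_of A \<inter> C"
  have "compactin M K"
    unfolding K_def using A closed_Int_compactin[of M C "M closure_of A"]
    by (simp add: C precompactin_def Int_commute)
  then have "compactin (subtopology M C) K"
    by (simp add: compactin_subtopology K_def)
  then have eK: "compactin M' (e ` K)"
    using image_compactin ce by blast
  have "B \<subseteq> e ` K"
  proof
    fix b assume b: "b \<in> B"
    then have "g b \<in> A" "g b \<in> C" using B gC by auto
    moreover have "A \<subseteq> M closure_of A"
      using A closure_of_subset unfolding precompactin_def by blast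
    ultimately show "b \<in> e ` K"
      using b B eg unfolding K_def by (intro image_eqI[of _ _ "g b"]) auto
  qed
  moreover have "closedin M' (e ` K)"
    using compactin_imp_closedin[OF metrizable_imp_Hausdorff_space[OF M'] eK] .
  ultimately have "M' closure_of B \<subseteq> e ` K"
    by (simp add: closure_of_minimal)
  then have "compactin M' (M' closure_of B)"
    using closed_compactin[OF eK] by simp
  then show ?thesis using B unfolding precompactin_def by blast
qed

lemma k_proper: "k_proper_map M Z f \<Longrightarrow> k_proper_map M' Z (f \<circ> g)"
  unfolding k_proper_map_def
proof (intro conjI allI impI)
  show "continuous_map M' Z (f \<circ> g)" by (rule cont)
  fix K
  assume "continuous_map M Z f \<and>
    (\<forall>K. precompactin Z K \<longrightarrow> precompactin M {x \<in> topspace M. f x \<in> K})" "precompactin Z K"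
  then have "precompactin M {x \<in> topspace M. f x \<in> K}" by blast
  then show "precompactin M' {x \<in> topspace M'. (f \<circ> g) x \<in> K}"
    by (rule precompact) (use gC CM in auto)
qed

lemma subproper:
  assumes "\<And>K. precompactin Z K \<Longrightarrow> precompactin M {x \<in> s ` topspace Z. f x \<in> K}"
  shows "subproper_map M' Z (f \<circ> g)"
  unfolding subproper_map_def
proof (intro conjI exI[of _ "e ` s ` topspace Z"] allI impI)
  show "continuous_map M' Z (f \<circ> g)" by (rule cont)
  show "e ` s ` topspace Z \<subseteq> topspace M'" using sC eC by auto
  have "f (g (e (s z))) = z" if "z \<in> topspace Z" for z
    using that sC ge s unfolding section_of_def by simp
  then show "(f \<circ> g) ` e ` s ` topspace Z = topspace Z"
    by (simp add: image_image)
  fix K assume "precompactin Z K"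
  from assms[OF this] show "precompactin M' {x \<in> e ` s ` topspace Z. (f \<circ> g) x \<in> K}"
    by (rule precompact) (use sC eC ge in auto)
qed

lemma seq_cont: "seq_continuous Z M s \<Longrightarrow> seq_continuous Z M' (e \<circ> s)"
  unfolding seq_continuous_def
proof (intro allI impI)
  fix z assume H: "\<forall>z. convergentin Z z \<longrightarrow> convergentin M (s \<circ> z)" and z: "convergentin Z z"
  then obtain l where l: "limitin M (s \<circ> z) l sequentially"
    unfolding convergentin_def by blast
  have sz: "\<And>n. s (z n) \<in> C" using z sC unfolding convergentin_def by auto
  have "l \<in> C"
    by (rule limitin_closedin[OF l]) (use sz C in auto)
  then have "limitin (subtopology M C) (s \<circ> z) l sequentially"
    using l sz by (simp add: limitin_subtopology)
  then have "limitin M' (e \<circ> (s \<circ> z)) (e l) sequentially"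
    by (rule continuous_map_limit[OF ce])
  then show "convergentin M' (e \<circ> s \<circ> z)"
    using sz eC unfolding convergentin_def by (auto simp: comp_assoc)
qed

lemma cs_star_cont: "cs_star_continuous Z M s \<Longrightarrow> cs_star_continuous Z M' (e \<circ> s)"
  unfolding cs_star_continuous_def
proof (intro allI impI)
  fix z assume H: "\<forall>z. convergentin Z z \<longrightarrow> (\<exists>p. accumulation_point M (s \<circ> z) p)"
    and z: "convergentin Z z"
  then obtain p where p: "accumulation_point M (s \<circ> z) p" by blast
  have sz: "\<And>n. s (z n) \<in> C" using z sC unfolding convergentin_def by auto
  have pC: "p \<in> C"
  proof (rule ccontr)
    assume "p \<notin> C"
    then have "openin M (topspace M - C)" "p \<in> topspace M - C"
      using p C unfolding accumulation_point_def by auto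
    then have "infinite {n. (s \<circ> z) n \<in> topspace M - C}"
      using p unfolding accumulation_point_def by blast
    then show False using sz by simp
  qed
  have "accumulation_point M' (e \<circ> s \<circ> z) (e p)"
    unfolding accumulation_point_def
  proof (intro conjI allI impI)
    show "e p \<in> topspace M'" using pC eC by blast
    fix U assume U: "openin M' U \<and> e p \<in> U"
    then have "openin (subtopology M C) {x \<in> topspace (subtopology M C). e x \<in> U}"
      using ce openin_continuous_map_preimage by blast
    then obtain V where V: "openin M V" "{x \<in> topspace (subtopology M C). e x \<in> U} = V \<inter> C"
      unfolding openin_subtopology by blast
    then have "p \<in> V" using U pC CM by auto
    then have "infinite {n. (s \<circ> z) n \<in> V}"
      using p V(1) unfolding accumulation_point_def by blast
    moreover have "{n. (s \<circ> z) n \<in> V} \<subseteq> {n. (e \<circ> s \<circ> z) n \<in> U}"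
      using V(2) sz by auto
    ultimately show "infinite {n. (e \<circ> s \<circ> z) n \<in> U}"
      using finite_subset by blast
  qed
  then show "\<exists>p. accumulation_point M' (e \<circ> s \<circ> z) p" by blast
qed

end

lemma metrizable_transfer_ex:
  fixes M :: "'m topology" and Z :: "'z topology"
  assumes "metrizable_space M" "continuous_map M Z f" "section_of M Z f s"
  obtains M' :: "(nat \<Rightarrow> 'z) topology" and e g C where "metrizable_transfer M Z f s M' e g C"
proof -
  have "s \<in> topspace Z \<rightarrow> topspace M" using assms(3) unfolding section_of_def by blast
  from metrizable_copy[OF assms(1) this] obtain M' :: "(nat \<Rightarrow> 'z) topology" and e g where
    "metrizable_space M'" "homeomorphic_maps (subtopology M (M closure_of s ` topspace Z)) M' e g"
    by blast
  then show ?thesis using that assms unfolding metrizable_transfer_def by blast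
qed

lemma section_exists:
  assumes "D \<subseteq> topspace M" "f ` D = topspace Z"
  obtains s where "section_of M Z f s" "s ` topspace Z \<subseteq> D"
proof -
  have "\<forall>z\<in>topspace Z. \<exists>x. x \<in> D \<and> f x = z"
    unfolding assms(2)[symmetric] by blast
  then obtain s where "\<forall>z\<in>topspace Z. s z \<in> D \<and> f (s z) = z"
    by metis
  then have "section_of M Z f s" "s ` topspace Z \<subseteq> D"
    using assms(1) unfolding section_of_def by auto
  then show ?thesis by (rule that)
qed

theorem k_metrizableI:
  fixes M :: "'m topology" and Z :: "'z topology"
  assumes "metrizable_space M" "k_proper_map M Z f" "f ` topspace M = topspace Z"
  shows "k_metrizable Z"
proof -
  obtain s where s: "section_of M Z f s"
    by (rule section_exists[OF subset_refl assms(3)])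
  have "continuous_map M Z f" using assms(2) unfolding k_proper_map_def by blast
  from metrizable_transfer_ex[OF assms(1) this s] obtain M' :: "(nat \<Rightarrow> 'z) topology" and e g C
    where "metrizable_transfer M Z f s M' e g C" by blast
  then interpret metrizable_transfer M Z f s M' e g C .
  show ?thesis unfolding k_metrizable_def using M' k_proper[OF assms(2)] surj by blast
qed

theorem k_star_metrizableI:
  fixes M :: "'m topology" and Z :: "'z topology"
  assumes "metrizable_space M" "subproper_map M Z f" "f ` topspace M = topspace Z"
  shows "k_star_metrizable Z"
proof -
  obtain D where D: "D \<subseteq> topspace M" "f ` D = topspace Z"
    "\<And>K. precompactin Z K \<Longrightarrow> precompactin M {x \<in> D. f x \<in> K}" and f: "continuous_map M Z f"
    using assms(2) unfolding subproper_map_def by blast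
  obtain s where sD: "section_of M Z f s" "s ` topspace Z \<subseteq> D"
    using section_exists[OF D(1,2)] by blast
  from metrizable_transfer_ex[OF assms(1) f sD(1)] obtain M' :: "(nat \<Rightarrow> 'z) topology" and e g C
    where "metrizable_transfer M Z f s M' e g C" by blast
  then interpret metrizable_transfer M Z f s M' e g C .
  have "precompactin M {x \<in> s ` topspace Z. f x \<in> K}" if "precompactin Z K" for K
  proof -
    have sub: "{x \<in> s ` topspace Z. f x \<in> K} \<subseteq> {x \<in> D. f x \<in> K}" using sD(2) by blast
    have P: "precompactin M {x \<in> D. f x \<in> K}" by (rule D(3)[OF that])
    have "compactin M (M closure_of {x \<in> s ` topspace Z. f x \<in> K})"
      by (rule closed_compactin[of _ "M closure_of {x \<in> D. f x \<in> K}"])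
        (use P in \<open>auto simp: precompactin_def intro: closure_of_mono[OF sub, THEN subsetD]\<close>)
    then show ?thesis using P sub unfolding precompactin_def by blast
  qed
  from subproper[OF this] show ?thesis
    unfolding k_star_metrizable_def using M' surj by blast
qed

theorem cs_metrizableI:
  fixes M :: "'m topology" and Z :: "'z topology"
  assumes "metrizable_space M" "continuous_map M Z f" "f ` topspace M = topspace Z"
    and "section_of M Z f s" "seq_continuous Z M s"
  shows "cs_metrizable Z"
proof -
  from metrizable_transfer_ex[OF assms(1,2,4)] obtain M' :: "(nat \<Rightarrow> 'z) topology" and e g C
    where "metrizable_transfer M Z f s M' e g C" by blast
  then interpret metrizable_transfer M Z f s M' e g C .
  show ?thesis unfolding cs_metrizable_def using M' cont surj sec seq_cont[OF assms(5)] by blast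
qed

theorem cs_star_metrizableI:
  fixes M :: "'m topology" and Z :: "'z topology"
  assumes "metrizable_space M" "continuous_map M Z f" "f ` topspace M = topspace Z"
    and "section_of M Z f s" "cs_star_continuous Z M s"
  shows "cs_star_metrizable Z"
proof -
  from metrizable_transfer_ex[OF assms(1,2,4)] obtain M' :: "(nat \<Rightarrow> 'z) topology" and e g C
    where "metrizable_transfer M Z f s M' e g C" by blast
  then interpret metrizable_transfer M Z f s M' e g C .
  show ?thesis
    unfolding cs_star_metrizable_def using M' cont surj sec cs_star_cont[OF assms(5)] by blast
qed

end

theory Submission
  imports Defs
begin

text \<open>
  The Banach space is \<open>\<ell>\<^sub>1\<close> over a large index set. By the Schur property its weakly compact sets are
  norm compact, so the identity from the norm topology to the weak topology is proper and
  \<open>(\<ell>\<^sub>1, weak)\<close> is \<open>k\<close>-metrizable; since weakly convergent sequences converge in norm, it is also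
  \<open>cs\<close>-metrizable. On the other hand every Banach space is a quotient of some \<open>\<ell>\<^sub>1\<close>, and for some of
  them (\<open>c\<^sub>0\<close> or \<open>\<ell>\<^sub>2\<close> over an uncountable set \<open>B\<close>, say) the unit vectors \<open>e\<^sub>b\<close> form an uncountable
  family, isolated in the weak topology, each of whose injective sequences converges weakly to \<open>0\<close>.
  Such a family excludes \<open>cs\<^sup>*\<close>-metrizability
  (\<open>uncountable_convergent_family_not_cs_star_metrizable\<close>): the values \<open>s (e\<^sub>b)\<close> of a section form a
  discrete subset of a metric space, hence, by uncountability, for some \<open>\<epsilon> > 0\<close> infinitely many of
  them have distance at least \<open>\<epsilon>\<close> from all the others; a sequence of these has no accumulation point.

  The quotient is studied through its functionals only. Let \<open>\<ell>\<^sub>1\<close> be indexed by (codes of) subsets of \<open>B\<close>,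
  with unit vectors \<open>\<delta>\<^sub>F\<close>, and let \<open>Y\<close> be the common kernel of the functionals
  \<open>x \<mapsto> (\<Sum>F\<ni>b. x\<^sub>F)\<close> for \<open>b \<in> B\<close>. For finite \<open>F\<close> the vector \<open>\<delta>\<^sub>F\<close> is congruent modulo \<open>Y\<close> to
  \<open>\<Sum>b\<in>F. \<delta>\<^bsub>{b}\<^esub>\<close>, so that a functional \<open>\<phi>\<close> on the quotient satisfies
  \<open>\<bar>\<Sum>b\<in>F. \<phi> \<delta>\<^bsub>{b}\<^esub>\<bar> \<le> \<parallel>\<phi>\<parallel>\<close> for all finite \<open>F\<close>. Hence \<open>\<phi> \<delta>\<^bsub>{b}\<^esub>\<close> is absolutely summable over \<open>b\<close> and the classes of
  the \<open>\<delta>\<^bsub>{b}\<^esub>\<close> behave like the unit vectors above; the functionals that define \<open>Y\<close> isolate them.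

  The statement about open maps follows because the quotient map is open for the weak topologies
  (\<open>open_map_q\<close>). The point is that finitely many functionals on the space can be controlled, after
  a translation by an element of \<open>Y\<close>, by finitely many functionals that vanish on \<open>Y\<close>; this is plain
  elimination in finitely many variables (\<open>annihilating_functionals_suffice\<close>).

  The Schur property is obtained by the gliding hump (\<open>gliding_hump\<close>). A sequence in a weakly compact
  set \<open>C\<close> has a subsequence that converges coordinatewise to a point of \<open>C\<close>, because only countably
  many coordinates matter; if it did not converge in norm, then the gliding hump would produce
  a functional that keeps a subsequence away from its only possible weak accumulation point.
\<close>

section \<open>Functionals and the weak topology of a normed space\<close>

locale real_normed_module =
  fixes E :: "'a normed_module" (structure)
  assumes normed: "normed_space E"
begin

lemma is_module: "module real_ring E"
  using normed unfolding normed_space_def by blast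

sublocale module real_ring E
  by (rule is_module)

sublocale N: Metric_space "carrier E" "ndist E"
  by (rule Metric_space_ndist[OF normed])

lemma scale_closed [simp]: "x \<in> carrier E \<Longrightarrow> c \<odot> x \<in> carrier E"
  using smult_closed[of c x] by (simp add: real_ring_def)

lemma norm_nonneg: "x \<in> carrier E \<Longrightarrow> 0 \<le> vnorm E x"
  using normed unfolding normed_space_def by blast

lemma norm_zero_iff: "x \<in> carrier E \<Longrightarrow> vnorm E x = 0 \<longleftrightarrow> x = \<zero>"
  using normed unfolding normed_space_def by blast

lemma norm_scale: "x \<in> carrier E \<Longrightarrow> vnorm E (c \<odot> x) = \<bar>c\<bar> * vnorm E x"
  using normed unfolding normed_space_def by blast

lemma topspace_norm [simp]: "topspace (norm_topology E) = carrier E"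
  unfolding norm_topology_def by simp

lemma dual_add: "\<phi> \<in> continuous_dual E \<Longrightarrow> x \<in> carrier E \<Longrightarrow> y \<in> carrier E \<Longrightarrow> \<phi> (x \<oplus> y) = \<phi> x + \<phi> y"
  and dual_scale: "\<phi> \<in> continuous_dual E \<Longrightarrow> x \<in> carrier E \<Longrightarrow> \<phi> (c \<odot> x) = c * \<phi> x"
  unfolding continuous_dual_def by auto

lemma dual_zero: "\<phi> \<in> continuous_dual E \<Longrightarrow> \<phi> \<zero> = 0"
  using dual_add[of \<phi> \<zero> \<zero>] by simp

lemma additive_diff:
  fixes \<phi> :: "'a \<Rightarrow> real"
  assumes add: "\<And>x y. x \<in> carrier E \<Longrightarrow> y \<in> carrier E \<Longrightarrow> \<phi> (x \<oplus> y) = \<phi> x + \<phi> y"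
    and xy: "x \<in> carrier E" "y \<in> carrier E"
  shows "\<phi> (x \<ominus> y) = \<phi> x - \<phi> y"
proof -
  have "\<phi> (x \<ominus> y) + \<phi> y = \<phi> (x \<ominus> y \<oplus> y)"
    using xy by (simp add: add)
  also have "x \<ominus> y \<oplus> y = x"
    using xy by (simp add: a_minus_def M.a_assoc M.l_neg)
  finally show ?thesis by simp
qed

lemma dual_diff:
  "\<phi> \<in> continuous_dual E \<Longrightarrow> x \<in> carrier E \<Longrightarrow> y \<in> carrier E \<Longrightarrow> \<phi> (x \<ominus> y) = \<phi> x - \<phi> y"
  by (rule additive_diff) (rule dual_add)

text \<open>
  A ball around \<open>\<zero>\<close> is mapped into \<open>{-1<..<1}\<close>; scaling a vector into it gives the bound.
\<close>

lemma dual_bounded: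
  assumes \<phi>: "\<phi> \<in> continuous_dual E"
  obtains B where "B \<ge> 0" "\<And>x. x \<in> carrier E \<Longrightarrow> \<bar>\<phi> x\<bar> \<le> B * vnorm E x"
proof -
  have "openin N.mtopology {x \<in> carrier E. \<phi> x \<in> {-1<..<1}}"
    using openin_continuous_map_preimage[of "norm_topology E" euclideanreal \<phi> "{-1<..<1}"] \<phi>
    unfolding continuous_dual_def by (simp add: norm_topology_def)
  moreover have "\<zero> \<in> {x \<in> carrier E. \<phi> x \<in> {-1<..<1}}"
    using dual_zero[OF \<phi>] by simp
  ultimately obtain r where r: "r > 0" "N.mball \<zero> r \<subseteq> {x \<in> carrier E. \<phi> x \<in> {-1<..<1}}"
    unfolding N.openin_mtopology by blast
  have small: "\<bar>\<phi> x\<bar> < 1" if "x \<in> carrier E" "vnorm E x < r" for x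
  proof -
    have "\<zero> \<ominus> x = \<ominus> x" using that by (simp add: a_minus_def)
    then have "x \<in> N.mball \<zero> r"
      using that vnorm_uminus[OF normed that(1)] unfolding N.in_mball ndist_def by simp
    then show ?thesis using r(2) by auto
  qed
  have "\<bar>\<phi> x\<bar> \<le> 2 / r * vnorm E x" if x: "x \<in> carrier E" for x
  proof (cases "vnorm E x = 0")
    case True
    then show ?thesis using norm_zero_iff[OF x] dual_zero[OF \<phi>] by simp
  next
    case False
    then have pos: "vnorm E x > 0" using norm_nonneg[OF x] by simp
    define c where "c = r / (2 * vnorm E x)"
    have c: "c > 0" unfolding c_def using pos r by simp
    have "vnorm E (c \<odot> x) < r"
      using pos r c by (simp add: norm_scale[OF x]) (simp add: c_def)
    then have "\<bar>c * \<phi> x\<bar> < 1"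
      using small[of "c \<odot> x"] x by (simp add: dual_scale[OF \<phi>])
    then have "\<bar>\<phi> x\<bar> < 1 / c" using c by (simp add: abs_mult field_simps)
    then show ?thesis unfolding c_def by simp
  qed
  then show ?thesis using that[of "2 / r"] r by simp
qed

lemma dualI:
  assumes add: "\<And>x y. x \<in> carrier E \<Longrightarrow> y \<in> carrier E \<Longrightarrow> \<phi> (x \<oplus> y) = \<phi> x + \<phi> y"
    and scale: "\<And>c x. x \<in> carrier E \<Longrightarrow> \<phi> (c \<odot> x) = c * \<phi> x"
    and bound: "\<And>x. x \<in> carrier E \<Longrightarrow> \<bar>\<phi> x\<bar> \<le> B * vnorm E x"
  shows "\<phi> \<in> continuous_dual E"
proof -
  have diff: "\<phi> (x \<ominus> y) = \<phi> x - \<phi> y" if "x \<in> carrier E" "y \<in> carrier E" for x y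
    by (rule additive_diff) (simp_all add: add that)
  have "openin N.mtopology {x \<in> carrier E. \<phi> x \<in> U}" if U: "open U" for U
    unfolding N.openin_mtopology
  proof (intro conjI allI impI)
    fix x assume "x \<in> {x \<in> carrier E. \<phi> x \<in> U}"
    then obtain e where x: "x \<in> carrier E" and e: "e > 0" "ball (\<phi> x) e \<subseteq> U"
      using U open_contains_ball by blast
    have "y \<in> {x \<in> carrier E. \<phi> x \<in> U}" if "y \<in> N.mball x (e / (\<bar>B\<bar> + 1))" for y
    proof -
      have y: "y \<in> carrier E" "vnorm E (x \<ominus> y) < e / (\<bar>B\<bar> + 1)"
        using that x unfolding N.in_mball ndist_def by auto
      have "\<bar>\<phi> x - \<phi> y\<bar> \<le> B * vnorm E (x \<ominus> y)"
        using bound[of "x \<ominus> y"] diff[OF x y(1)] x y by simp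
      also have "\<dots> \<le> (\<bar>B\<bar> + 1) * vnorm E (x \<ominus> y)"
        using x y norm_nonneg[of "x \<ominus> y"] by (intro mult_right_mono) auto
      also have "\<dots> < e" using y(2) by (simp add: field_simps)
      finally show ?thesis using e y(1) by (auto simp: dist_real_def)
    qed
    moreover have "e / (\<bar>B\<bar> + 1) > 0" using e by simp
    ultimately show "\<exists>r>0. N.mball x r \<subseteq> {x \<in> carrier E. \<phi> x \<in> U}" by blast
  qed auto
  then have "continuous_map (norm_topology E) euclideanreal \<phi>"
    unfolding continuous_map_def norm_topology_def by simp
  then show ?thesis using add scale unfolding continuous_dual_def by blast
qed

lemma zero_in_dual: "(\<lambda>x. 0) \<in> continuous_dual E"
  by (rule dualI[of _ 0]) auto

lemma dual_minus_scaled: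
  assumes \<phi>: "\<phi> \<in> continuous_dual E" and \<psi>: "\<psi> \<in> continuous_dual E"
  shows "(\<lambda>x. \<phi> x - c * \<psi> x) \<in> continuous_dual E"
proof -
  obtain A where A: "A \<ge> 0" "\<And>x. x \<in> carrier E \<Longrightarrow> \<bar>\<phi> x\<bar> \<le> A * vnorm E x"
    using dual_bounded[OF \<phi>] by blast
  obtain B where B: "B \<ge> 0" "\<And>x. x \<in> carrier E \<Longrightarrow> \<bar>\<psi> x\<bar> \<le> B * vnorm E x"
    using dual_bounded[OF \<psi>] by blast
  show ?thesis
  proof (rule dualI[of _ "A + \<bar>c\<bar> * B"])
    fix x assume x: "x \<in> carrier E"
    have "\<bar>\<phi> x - c * \<psi> x\<bar> \<le> \<bar>\<phi> x\<bar> + \<bar>c\<bar> * \<bar>\<psi> x\<bar>"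
      by (metis abs_mult abs_triangle_ineq4)
    also have "\<dots> \<le> A * vnorm E x + \<bar>c\<bar> * (B * vnorm E x)"
      using A(2)[OF x] B(2)[OF x] by (intro add_mono mult_left_mono) auto
    finally show "\<bar>\<phi> x - c * \<psi> x\<bar> \<le> (A + \<bar>c\<bar> * B) * vnorm E x"
      by (simp add: algebra_simps)
  qed (simp_all add: dual_add[OF \<phi>] dual_add[OF \<psi>] dual_scale[OF \<phi>] dual_scale[OF \<psi>] algebra_simps)
qed

lemma openin_weak_preimage:
  "\<phi> \<in> continuous_dual E \<Longrightarrow> open U \<Longrightarrow> openin (weak_topology E) {x \<in> carrier E. \<phi> x \<in> U}"
  unfolding weak_topology_def by (rule topology_generated_by_Basis) blast

lemma topspace_weak [simp]: "topspace (weak_topology E) = carrier E"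
proof -
  have "{{x \<in> carrier E. \<phi> x \<in> U} | \<phi> U. \<phi> \<in> continuous_dual E \<and> open U} \<subseteq> Pow (carrier E)"
    by auto
  moreover have "carrier E = {x \<in> carrier E. (\<lambda>x. 0::real) x \<in> UNIV}" by simp
  then have "carrier E \<in> {{x \<in> carrier E. \<phi> x \<in> U} | \<phi> U. \<phi> \<in> continuous_dual E \<and> open U}"
    using zero_in_dual open_UNIV by blast
  ultimately show ?thesis
    unfolding weak_topology_def topology_generated_by_topspace by blast
qed

lemma continuous_map_weak_dual:
  "\<phi> \<in> continuous_dual E \<Longrightarrow> continuous_map (weak_topology E) euclideanreal \<phi>"
  unfolding continuous_map_def by (auto intro: openin_weak_preimage)

lemma weak_basic_neighbourhood:
  assumes "openin (weak_topology E) W" "a \<in> W"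
  obtains \<Phi> e where "finite \<Phi>" "\<Phi> \<subseteq> continuous_dual E" "e > 0"
    "{x \<in> carrier E. \<forall>\<phi>\<in>\<Phi>. \<bar>\<phi> x - \<phi> a\<bar> < e} \<subseteq> W"
proof -
  have "generate_topology_on {{x \<in> carrier E. \<phi> x \<in> U} | \<phi> U. \<phi> \<in> continuous_dual E \<and> open U} W"
    using assms(1) unfolding weak_topology_def openin_topology_generated_by_iff .
  then have "\<exists>\<Phi> e. finite \<Phi> \<and> \<Phi> \<subseteq> continuous_dual E \<and> e > 0 \<and>
      {x \<in> carrier E. \<forall>\<phi>\<in>\<Phi>. \<bar>\<phi> x - \<phi> a\<bar> < e} \<subseteq> W"
    using assms(2)
  proof induction
    case Empty
    then show ?case by simp
  next
    case (Int V W)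
    then obtain \<Phi> d \<Psi> e where
      "finite \<Phi>" "\<Phi> \<subseteq> continuous_dual E" "d > 0" "{x \<in> carrier E. \<forall>\<phi>\<in>\<Phi>. \<bar>\<phi> x - \<phi> a\<bar> < d} \<subseteq> V"
      "finite \<Psi>" "\<Psi> \<subseteq> continuous_dual E" "e > 0" "{x \<in> carrier E. \<forall>\<phi>\<in>\<Psi>. \<bar>\<phi> x - \<phi> a\<bar> < e} \<subseteq> W"
      by auto
    then show ?case
      by (intro exI[of _ "\<Phi> \<union> \<Psi>"] exI[of _ "min d e"]) auto
  next
    case (UN K)
    then show ?case by (meson Union_upper UnionE subset_trans)
  next
    case (Basis S)
    then obtain \<phi> U where S: "S = {x \<in> carrier E. \<phi> x \<in> U}" "\<phi> \<in> continuous_dual E" "open U"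
      by auto
    then obtain e where "e > 0" "ball (\<phi> a) e \<subseteq> U"
      using Basis open_contains_ball by blast
    then show ?case
      using S by (intro exI[of _ "{\<phi>}"] exI[of _ e]) (auto simp: dist_real_def subset_iff)
  qed
  then show ?thesis using that by blast
qed

lemma limitin_weak:
  assumes l: "l \<in> carrier E" and z: "range z \<subseteq> carrier E"
    and lim: "\<And>\<phi>. \<phi> \<in> continuous_dual E \<Longrightarrow> (\<lambda>n. \<phi> (z n)) \<longlonglongrightarrow> \<phi> l"
  shows "limitin (weak_topology E) z l sequentially"
  unfolding limitin_def
proof (intro conjI allI impI)
  fix W assume W: "openin (weak_topology E) W \<and> l \<in> W"
  obtain \<Phi> e where \<Phi>: "finite \<Phi>" "\<Phi> \<subseteq> continuous_dual E" "e > 0"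
    "{x \<in> carrier E. \<forall>\<phi>\<in>\<Phi>. \<bar>\<phi> x - \<phi> l\<bar> < e} \<subseteq> W"
    by (rule weak_basic_neighbourhood[OF W[THEN conjunct1] W[THEN conjunct2]])
  have "eventually (\<lambda>n. \<bar>\<phi> (z n) - \<phi> l\<bar> < e) sequentially" if "\<phi> \<in> \<Phi>" for \<phi>
    using tendstoD[OF lim \<open>e > 0\<close>] that \<Phi>(2) by (auto simp: dist_real_def)
  then have "eventually (\<lambda>n. \<forall>\<phi>\<in>\<Phi>. \<bar>\<phi> (z n) - \<phi> l\<bar> < e) sequentially"
    using \<Phi>(1) by (simp add: eventually_ball_finite)
  then show "eventually (\<lambda>n. z n \<in> W) sequentially"
    by eventually_elim (use \<Phi>(4) z in blast)
qed (use l in simp)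

lemma Hausdorff_weak:
  assumes "\<And>x y. x \<in> carrier E \<Longrightarrow> y \<in> carrier E \<Longrightarrow> x \<noteq> y \<Longrightarrow> \<exists>\<phi>\<in>continuous_dual E. \<phi> x \<noteq> \<phi> y"
  shows "Hausdorff_space (weak_topology E)"
  unfolding Hausdorff_space_def
proof (intro allI impI)
  fix x y assume xy: "x \<in> topspace (weak_topology E) \<and> y \<in> topspace (weak_topology E) \<and> x \<noteq> y"
  then obtain \<phi> where \<phi>: "\<phi> \<in> continuous_dual E" "\<phi> x \<noteq> \<phi> y"
    using assms by auto
  then obtain U V where "open U" "open V" "\<phi> x \<in> U" "\<phi> y \<in> V" "U \<inter> V = {}"
    using hausdorff[OF \<phi>(2)] by blast
  then show "\<exists>U V. openin (weak_topology E) U \<and> openin (weak_topology E) V \<and> x \<in> U \<and> y \<in> V \<and> disjnt U V"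
    using xy \<phi> openin_weak_preimage[OF \<phi>(1), of U] openin_weak_preimage[OF \<phi>(1), of V]
    by (intro exI[of _ "{x \<in> carrier E. \<phi> x \<in> U}"] exI[of _ "{x \<in> carrier E. \<phi> x \<in> V}"])
      (auto simp: disjnt_def)
qed

lemma continuous_map_norm_weak: "continuous_map (norm_topology E) (weak_topology E) id"
  unfolding weak_topology_def
proof (rule continuous_on_generated_topo)
  show "openin (norm_topology E) (id -` U \<inter> topspace (norm_topology E))"
    if U: "U \<in> {{x \<in> carrier E. \<phi> x \<in> U} | \<phi> U. \<phi> \<in> continuous_dual E \<and> open U}" for U
  proof -
    obtain \<phi> V where "U = {x \<in> carrier E. \<phi> x \<in> V}" "\<phi> \<in> continuous_dual E" "open V"
      using U by blast
    moreover from this have "openin (norm_topology E) {x \<in> topspace (norm_topology E). \<phi> x \<in> V}"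
      by (intro openin_continuous_map_preimage[of _ euclideanreal]) (auto simp: continuous_dual_def)
    moreover have "id -` U \<inter> topspace (norm_topology E) = U" using calculation by auto
    ultimately show ?thesis by simp
  qed
  show "id ` topspace (norm_topology E) \<subseteq>
      \<Union> {{x \<in> carrier E. \<phi> x \<in> U} | \<phi> U. \<phi> \<in> continuous_dual E \<and> open U}"
    using topspace_weak unfolding weak_topology_def topology_generated_by_topspace by simp
qed

lemma annihilator_closed_subspace:
  assumes \<Phi>: "\<Phi> \<subseteq> continuous_dual E"
  shows "closed_linear_subspace {x \<in> carrier E. \<forall>\<phi>\<in>\<Phi>. \<phi> x = 0} E"
  unfolding closed_linear_subspace_def
proof
  show "submodule {x \<in> carrier E. \<forall>\<phi>\<in>\<Phi>. \<phi> x = 0} real_ring E"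
  proof (rule submoduleI)
    show "\<ominus> x \<in> {x \<in> carrier E. \<forall>\<phi>\<in>\<Phi>. \<phi> x = 0}"
      if "x \<in> {x \<in> carrier E. \<forall>\<phi>\<in>\<Phi>. \<phi> x = 0}" for x
    proof -
      have "\<phi> (\<ominus> x) = 0" if "\<phi> \<in> \<Phi>" for \<phi>
        using dual_diff[of \<phi> \<zero> x] dual_zero[of \<phi>] \<Phi> that \<open>x \<in> _\<close>
        by (auto simp: a_minus_def)
      then show ?thesis using that by simp
    qed
  qed (use \<Phi> in \<open>auto simp: dual_zero dual_add dual_scale subset_iff\<close>)
  have "closedin (norm_topology E)
      (carrier E \<inter> \<Inter> ((\<lambda>\<phi>. {x \<in> topspace (norm_topology E). \<phi> x \<in> {0}}) ` \<Phi>))"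
  proof (cases "\<Phi> = {}")
    case True
    then show ?thesis using closedin_topspace[of "norm_topology E"] by simp
  next
    case False
    have "closedin (norm_topology E) {x \<in> topspace (norm_topology E). \<phi> x \<in> {0}}" if "\<phi> \<in> \<Phi>" for \<phi>
      by (rule closedin_continuous_map_preimage[of _ euclideanreal])
        (use \<Phi> that in \<open>auto simp: continuous_dual_def\<close>)
    then show ?thesis
      using False closedin_topspace[of "norm_topology E"]
      by (intro closedin_Int closedin_INT) auto
  qed
  moreover have "carrier E \<inter> \<Inter> ((\<lambda>\<phi>. {x \<in> topspace (norm_topology E). \<phi> x \<in> {0}}) ` \<Phi>)
      = {x \<in> carrier E. \<forall>\<phi>\<in>\<Phi>. \<phi> x = 0}" by auto
  ultimately show "closedin (norm_topology E) {x \<in> carrier E. \<forall>\<phi>\<in>\<Phi>. \<phi> x = 0}" by simp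
qed

end

section \<open>The weak topology of a quotient space\<close>

text \<open>
  Below, \<open>q\<close> is the canonical map of a normed space \<open>E\<close> onto its quotient \<open>Q\<close> by a closed linear
  subspace \<open>Y\<close>.
\<close>

locale normed_quotient = real_normed_module +
  fixes Y
  assumes closed_subspace: "closed_linear_subspace Y E"
begin

abbreviation Q where "Q \<equiv> quotient_space E Y"
abbreviation q where "q x \<equiv> Y +>\<^bsub>E\<^esub> x"

lemma Y_submodule: "submodule Y real_ring E"
  using closed_subspace unfolding closed_linear_subspace_def by blast

lemma Y_carrier: "y \<in> Y \<Longrightarrow> y \<in> carrier E"
  using submoduleE(1)[OF Y_submodule] by blast

sublocale S: abelian_subgroup Y E
  using abelian_subgroupI2 submodule.axioms(1)[OF Y_submodule] M.a_comm_group by blast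

sublocale Q: real_normed_module "quotient_space E Y"
  by standard (rule normed_space_quotient_space[OF normed closed_subspace])

lemma carrier_Q: "carrier Q = q ` carrier E"
  unfolding quotient_space_def A_RCOSETS_def' by auto

lemma q_closed [simp]: "x \<in> carrier E \<Longrightarrow> q x \<in> carrier Q"
  unfolding carrier_Q by blast

lemma q_self: "x \<in> carrier E \<Longrightarrow> x \<in> q x"
  by (rule S.a_rcos_self)

lemma q_subset: "x \<in> carrier E \<Longrightarrow> a \<in> q x \<Longrightarrow> a \<in> carrier E"
  using M.a_r_coset_subset_G[OF submoduleE(1)[OF Y_submodule]] by blast

lemma q_eq: "x \<in> carrier E \<Longrightarrow> a \<in> q x \<Longrightarrow> q a = q x"
  using M.a_repr_independence[of a Y x] submodule.axioms(1)[OF Y_submodule] by simp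

lemma q_plus: "x \<in> carrier E \<Longrightarrow> y \<in> carrier E \<Longrightarrow> q x \<oplus>\<^bsub>Q\<^esub> q y = q (x \<oplus> y)"
  unfolding quotient_space_def by (simp add: S.a_rcos_sum)

lemma q_add_Y: "x \<in> carrier E \<Longrightarrow> y \<in> Y \<Longrightarrow> q (y \<oplus> x) = q x"
  by (rule q_eq) (auto simp: a_r_coset_def')

lemma q_scale:
  assumes x: "x \<in> carrier E"
  shows "c \<odot>\<^bsub>Q\<^esub> q x = q (c \<odot> x)"
proof -
  have "q (c \<odot> a) = q (c \<odot> x)" if a: "a \<in> q x" for a
  proof -
    obtain y where y: "y \<in> Y" "a = y \<oplus> x"
      using a unfolding a_r_coset_def' by auto
    have "c \<odot> a = c \<odot> y \<oplus> c \<odot> x"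
      using y x Y_carrier smult_r_distr[of c y x] by (simp add: real_ring_def)
    moreover have "c \<odot> y \<in> Y"
      using submoduleE(4)[OF Y_submodule, of c y] y by (simp add: real_ring_def)
    ultimately show ?thesis using q_add_Y x by simp
  qed
  then have "(\<Union>a\<in>q x. q (c \<odot> a)) = q (c \<odot> x)"
    using q_self[OF x] by blast
  then show ?thesis unfolding quotient_space_def by simp
qed

lemma q_norm_le:
  assumes x: "x \<in> carrier E" and a: "a \<in> q x"
  shows "vnorm Q (q x) \<le> vnorm E a"
proof -
  have "bdd_below (vnorm E ` q x)"
    using norm_nonneg q_subset[OF x] by (intro bdd_belowI[of _ 0]) auto
  then show ?thesis
    unfolding quotient_space_def using a by (simp add: cINF_lower)
qed

lemma q_norm_greatest:
  assumes "x \<in> carrier E" "\<And>a. a \<in> q x \<Longrightarrow> r \<le> vnorm E a"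
  shows "r \<le> vnorm Q (q x)"
  unfolding quotient_space_def using assms q_self[of x] by (auto intro!: cINF_greatest)

text \<open>
  This lemma and \<open>dual_descends\<close> identify the dual of \<open>Q\<close> with the functionals on \<open>E\<close> that vanish
  on \<open>Y\<close>.
\<close>

lemma dual_pullback:
  assumes \<phi>: "\<phi> \<in> continuous_dual Q"
  shows "(\<lambda>x. \<phi> (q x)) \<in> continuous_dual E"
proof -
  obtain B where B: "B \<ge> 0" "\<And>A. A \<in> carrier Q \<Longrightarrow> \<bar>\<phi> A\<bar> \<le> B * vnorm Q A"
    using Q.dual_bounded[OF \<phi>] by blast
  show ?thesis
  proof (rule dualI[of _ B])
    fix x assume x: "x \<in> carrier E"
    have "\<bar>\<phi> (q x)\<bar> \<le> B * vnorm Q (q x)" using B(2) x by simp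
    also have "\<dots> \<le> B * vnorm E x"
      using B(1) q_norm_le[OF x q_self[OF x]] by (rule mult_left_mono[rotated])
    finally show "\<bar>\<phi> (q x)\<bar> \<le> B * vnorm E x" .
  qed (simp_all add: Q.dual_add[OF \<phi>, symmetric] Q.dual_scale[OF \<phi>, symmetric] q_plus q_scale)
qed

lemma q_Y: "y \<in> Y \<Longrightarrow> q y = Y"
  using q_add_Y[of \<zero> y] Y_carrier M.a_coset_join2[OF _ submodule.axioms(1)[OF Y_submodule], of \<zero>]
    submodule.axioms(1)[OF Y_submodule]
  by (simp add: M.a_coset_join2)

lemma dual_pullback_Y:
  assumes "\<phi> \<in> continuous_dual Q" "y \<in> Y"
  shows "\<phi> (q y) = 0"
proof -
  have "Y = \<zero>\<^bsub>Q\<^esub>" unfolding quotient_space_def by simp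
  then show ?thesis using q_Y[OF assms(2)] Q.dual_zero[OF assms(1)] by simp
qed

text \<open>
  The descended functional keeps the bound of \<open>\<psi>\<close>, since \<open>\<psi>\<close> is constant on each coset and the quotient
  norm is the infimum of the norms of the representatives.
\<close>

lemma dual_descends:
  assumes \<psi>: "\<psi> \<in> continuous_dual E" and Y0: "\<And>y. y \<in> Y \<Longrightarrow> \<psi> y = 0"
  obtains \<phi> where "\<phi> \<in> continuous_dual Q" "\<And>x. x \<in> carrier E \<Longrightarrow> \<phi> (q x) = \<psi> x"
proof -
  define \<phi> where "\<phi> A = \<psi> (SOME a. a \<in> A)" for A
  have const: "\<psi> a = \<psi> x" if x: "x \<in> carrier E" and a: "a \<in> q x" for a x
  proof -
    obtain y where "y \<in> Y" "a = y \<oplus> x" using a unfolding a_r_coset_def' by auto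
    then show ?thesis using dual_add[OF \<psi>, of y x] Y_carrier Y0 x by simp
  qed
  have \<phi>q: "\<phi> (q x) = \<psi> x" if "x \<in> carrier E" for x
    unfolding \<phi>_def by (rule const[OF that someI[of "\<lambda>a. a \<in> q x", OF q_self[OF that]]])
  obtain B where B: "B \<ge> 0" "\<And>x. x \<in> carrier E \<Longrightarrow> \<bar>\<psi> x\<bar> \<le> B * vnorm E x"
    using dual_bounded[OF \<psi>] by blast
  have "\<phi> \<in> continuous_dual Q"
  proof (rule Q.dualI[of _ B])
    fix A A' assume "A \<in> carrier Q" "A' \<in> carrier Q"
    then show "\<phi> (A \<oplus>\<^bsub>Q\<^esub> A') = \<phi> A + \<phi> A'"
      unfolding carrier_Q by (auto simp: q_plus \<phi>q dual_add[OF \<psi>])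
  next
    fix c A assume "A \<in> carrier Q"
    then show "\<phi> (c \<odot>\<^bsub>Q\<^esub> A) = c * \<phi> A"
      unfolding carrier_Q by (auto simp: q_scale \<phi>q dual_scale[OF \<psi>])
  next
    fix A assume "A \<in> carrier Q"
    then obtain x where x: "x \<in> carrier E" "A = q x" unfolding carrier_Q by auto
    show "\<bar>\<phi> A\<bar> \<le> B * vnorm Q A"
    proof (cases "B = 0")
      case True
      then show ?thesis using B(2)[OF x(1)] \<phi>q x by simp
    next
      case False
      have "\<bar>\<psi> x\<bar> / B \<le> vnorm Q (q x)"
      proof (rule q_norm_greatest[OF x(1)])
        fix a assume "a \<in> q x"
        then show "\<bar>\<psi> x\<bar> / B \<le> vnorm E a"
          using B False const[OF x(1), of a] B(2)[of a] q_subset[OF x(1), of a]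
          by (simp add: field_simps)
      qed
      then show ?thesis using False B(1) \<phi>q x by (simp add: field_simps)
    qed
  qed
  then show ?thesis using that \<phi>q by blast
qed

lemma continuous_map_q: "continuous_map (weak_topology E) (weak_topology Q) q"
  unfolding weak_topology_def[of Q]
proof (rule continuous_on_generated_topo)
  fix U assume "U \<in> {{A \<in> carrier Q. \<phi> A \<in> U} | \<phi> U. \<phi> \<in> continuous_dual Q \<and> open U}"
  then obtain \<phi> V where U: "U = {A \<in> carrier Q. \<phi> A \<in> V}" "\<phi> \<in> continuous_dual Q" "open V"
    by blast
  have "q -` U \<inter> topspace (weak_topology E) = {x \<in> carrier E. \<phi> (q x) \<in> V}"
    unfolding U by auto
  then show "openin (weak_topology E) (q -` U \<inter> topspace (weak_topology E))"
    using openin_weak_preimage[OF dual_pullback[OF U(2)] U(3)] by simp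
next
  show "q ` topspace (weak_topology E) \<subseteq>
      \<Union> {{A \<in> carrier Q. \<phi> A \<in> U} | \<phi> U. \<phi> \<in> continuous_dual Q \<and> open U}"
    using Q.topspace_weak unfolding weak_topology_def[of Q] topology_generated_by_topspace
    by (simp add: carrier_Q)
qed

text \<open>
  The functionals in \<open>\<Phi>\<close> are eliminated one by one. One that vanishes on \<open>Y\<close> is put into \<open>\<Psi>\<close>. If
  \<open>\<phi> y\<^sub>0 = 1\<close> for some \<open>y\<^sub>0 \<in> Y\<close>, then the others are replaced by \<open>f - f y\<^sub>0 \<cdot> \<phi>\<close>, which do not see \<open>y\<^sub>0\<close>,
  and at the end a multiple of \<open>y\<^sub>0\<close> is added to match the value of \<open>\<phi>\<close> exactly.
\<close>

lemma annihilating_functionals_suffice: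
  assumes "set \<Phi> \<subseteq> continuous_dual E" "e > 0"
  shows "\<exists>\<Psi>. finite \<Psi> \<and> \<Psi> \<subseteq> continuous_dual E \<and> (\<forall>\<psi>\<in>\<Psi>. \<forall>y\<in>Y. \<psi> y = 0) \<and>
    (\<forall>x\<in>carrier E. (\<forall>\<psi>\<in>\<Psi>. \<bar>\<psi> x\<bar> < e) \<longrightarrow> (\<exists>y\<in>Y. \<forall>\<phi>\<in>set \<Phi>. \<bar>\<phi> x - \<phi> y\<bar> < e))"
  using assms(1)
proof (induction "length \<Phi>" arbitrary: \<Phi>)
  case 0
  have "\<exists>y. y \<in> Y"
    using S.zero_closed by blast
  then show ?case using 0 by (intro exI[of _ "{}"]) auto
next
  case (Suc n)
  then obtain \<phi> \<Phi>' where \<Phi>: "\<Phi> = \<phi> # \<Phi>'" "length \<Phi>' = n"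
    by (metis length_Suc_conv)
  have \<phi>: "\<phi> \<in> continuous_dual E" and \<Phi>': "set \<Phi>' \<subseteq> continuous_dual E"
    using Suc.prems unfolding \<Phi> by auto
  show ?case
  proof (cases "\<forall>y\<in>Y. \<phi> y = 0")
    case True
    obtain \<Psi> where \<Psi>: "finite \<Psi>" "\<Psi> \<subseteq> continuous_dual E" "\<forall>\<psi>\<in>\<Psi>. \<forall>y\<in>Y. \<psi> y = 0"
      "\<forall>x\<in>carrier E. (\<forall>\<psi>\<in>\<Psi>. \<bar>\<psi> x\<bar> < e) \<longrightarrow> (\<exists>y\<in>Y. \<forall>\<phi>\<in>set \<Phi>'. \<bar>\<phi> x - \<phi> y\<bar> < e)"
      using Suc.hyps(1)[OF \<Phi>(2)[symmetric] \<Phi>'] by blast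
    show ?thesis
      by (rule exI[of _ "insert \<phi> \<Psi>"]) (use \<Psi> \<phi> True in \<open>auto simp: \<Phi>\<close>)
  next
    case False
    then obtain y1 where y1: "y1 \<in> Y" "\<phi> y1 \<noteq> 0" by blast
    define y0 where "y0 = inverse (\<phi> y1) \<odot> y1"
    have y0: "y0 \<in> Y" "\<phi> y0 = 1"
      using submoduleE(4)[OF Y_submodule, of "inverse (\<phi> y1)" y1] y1 dual_scale[OF \<phi>] Y_carrier
      unfolding y0_def by (auto simp: real_ring_def)
    define g where "g f = (\<lambda>x. f x - f y0 * \<phi> x)" for f :: "'a \<Rightarrow> real"
    have g: "set (map g \<Phi>') \<subseteq> continuous_dual E"
      using \<Phi>' dual_minus_scaled[OF _ \<phi>] unfolding g_def by auto
    obtain \<Psi> where \<Psi>: "finite \<Psi>" "\<Psi> \<subseteq> continuous_dual E" "\<forall>\<psi>\<in>\<Psi>. \<forall>y\<in>Y. \<psi> y = 0"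
      "\<forall>x\<in>carrier E. (\<forall>\<psi>\<in>\<Psi>. \<bar>\<psi> x\<bar> < e) \<longrightarrow> (\<exists>y\<in>Y. \<forall>f\<in>set (map g \<Phi>'). \<bar>f x - f y\<bar> < e)"
      using Suc.hyps(1)[OF _ g] \<Phi>(2) by auto
    have "\<exists>y\<in>Y. \<forall>f\<in>set \<Phi>. \<bar>f x - f y\<bar> < e"
      if x: "x \<in> carrier E" and small: "\<forall>\<psi>\<in>\<Psi>. \<bar>\<psi> x\<bar> < e" for x
    proof -
      obtain y where y: "y \<in> Y" "\<forall>f\<in>set \<Phi>'. \<bar>g f x - g f y\<bar> < e"
        using \<Psi>(4) x small by auto
      define y' where "y' = y \<oplus> (\<phi> x - \<phi> y) \<odot> y0"
      have y': "y' \<in> Y"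
        using submoduleE(4,5)[OF Y_submodule] y y0 unfolding y'_def by (simp add: real_ring_def)
      have val: "f y' = f y + (\<phi> x - \<phi> y) * f y0" if "f \<in> continuous_dual E" for f
        unfolding y'_def using that y y0 Y_carrier by (simp add: dual_add dual_scale)
      have "\<bar>f x - f y'\<bar> < e" if "f \<in> set \<Phi>'" for f
      proof -
        have "f x - f y' = g f x - g f y"
          using val[of f] \<Phi>' that unfolding g_def by (auto simp: algebra_simps)
        then show ?thesis using y(2) that by simp
      qed
      moreover have "\<phi> x - \<phi> y' = 0" using val[OF \<phi>] y0 by simp
      ultimately show ?thesis using y' assms(2) unfolding \<Phi> by (intro bexI[of _ y']) auto
    qed
    then show ?thesis using \<Psi> by blast
  qed
qed

text \<open>
  Around a point \<open>a\<close> of a weakly open set \<open>W\<close> there is a basic neighbourhood given by finitely many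
  functionals \<open>\<Phi>\<close>. The functionals \<open>\<Psi>\<close> that \<open>annihilating_functionals_suffice\<close> yields for \<open>\<Phi>\<close> descend to
  the quotient, and the neighbourhood of \<open>q a\<close> that they define lies in the image of \<open>W\<close>.
\<close>

lemma open_map_q: "open_map (weak_topology E) (weak_topology Q) q"
  unfolding open_map_def
proof (intro allI impI)
  fix W assume W: "openin (weak_topology E) W"
  then have WE: "W \<subseteq> carrier E" using openin_subset by fastforce
  show "openin (weak_topology Q) (q ` W)"
  proof (rule openin_subopen[THEN iffD2], intro ballI)
    fix A assume "A \<in> q ` W"
    then obtain a where a: "a \<in> W" "A = q a" by blast
    have aE: "a \<in> carrier E" using a WE by blast
    obtain \<Phi> e where \<Phi>: "finite \<Phi>" "\<Phi> \<subseteq> continuous_dual E" "e > 0"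
      "{x \<in> carrier E. \<forall>\<phi>\<in>\<Phi>. \<bar>\<phi> x - \<phi> a\<bar> < e} \<subseteq> W"
      by (rule weak_basic_neighbourhood[OF W a(1)])
    obtain \<Phi>l where \<Phi>l: "set \<Phi>l = \<Phi>" using finite_list[OF \<Phi>(1)] by blast
    obtain \<Psi> where \<Psi>: "finite \<Psi>" "\<Psi> \<subseteq> continuous_dual E" "\<forall>\<psi>\<in>\<Psi>. \<forall>y\<in>Y. \<psi> y = 0"
      "\<forall>x\<in>carrier E. (\<forall>\<psi>\<in>\<Psi>. \<bar>\<psi> x\<bar> < e) \<longrightarrow> (\<exists>y\<in>Y. \<forall>\<phi>\<in>\<Phi>. \<bar>\<phi> x - \<phi> y\<bar> < e)"
      using annihilating_functionals_suffice[of \<Phi>l e, unfolded \<Phi>l, OF \<Phi>(2,3)]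
      by (elim exE conjE)
    have "\<forall>\<psi>\<in>\<Psi>. \<exists>\<phi>. \<phi> \<in> continuous_dual Q \<and> (\<forall>x\<in>carrier E. \<phi> (q x) = \<psi> x)"
    proof
      fix \<psi> assume "\<psi> \<in> \<Psi>"
      then have "\<psi> \<in> continuous_dual E" "\<And>y. y \<in> Y \<Longrightarrow> \<psi> y = 0"
        using \<Psi>(2,3) by auto
      from dual_descends[OF this] obtain \<phi>
        where "\<phi> \<in> continuous_dual Q" "\<And>x. x \<in> carrier E \<Longrightarrow> \<phi> (q x) = \<psi> x"
        by blast
      then show "\<exists>\<phi>. \<phi> \<in> continuous_dual Q \<and> (\<forall>x\<in>carrier E. \<phi> (q x) = \<psi> x)" by blast
    qed
    then obtain d where d: "\<And>\<psi>. \<psi> \<in> \<Psi> \<Longrightarrow> d \<psi> \<in> continuous_dual Q"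
      "\<And>\<psi> x. \<psi> \<in> \<Psi> \<Longrightarrow> x \<in> carrier E \<Longrightarrow> d \<psi> (q x) = \<psi> x"
      by metis
    define T where "T = carrier Q \<inter> \<Inter> ((\<lambda>\<psi>. {B \<in> carrier Q. d \<psi> B \<in> ball (\<psi> a) e}) ` \<Psi>)"
    have "openin (weak_topology Q) T"
    proof (cases "\<Psi> = {}")
      case True
      then show ?thesis unfolding T_def using openin_topspace[of "weak_topology Q"] by simp
    next
      case False
      then show ?thesis unfolding T_def
        using openin_topspace[of "weak_topology Q"] \<Psi>(1) d(1) Q.openin_weak_preimage
        by (intro openin_Int openin_INT2) (auto simp del: mem_ball)
    qed
    moreover have "A \<in> T"
      unfolding T_def using a aE d(2) \<Phi>(3) by simp
    moreover have "T \<subseteq> q ` W"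
    proof
      fix B assume B: "B \<in> T"
      then obtain x where x: "x \<in> carrier E" "B = q x" unfolding T_def carrier_Q by auto
      have "\<bar>\<psi> (x \<ominus> a)\<bar> < e" if "\<psi> \<in> \<Psi>" for \<psi>
      proof -
        have "\<psi> \<in> continuous_dual E" using that \<Psi>(2) by blast
        moreover have "\<bar>\<psi> a - d \<psi> (q x)\<bar> < e"
          using B that x(2) unfolding T_def by (simp add: dist_real_def)
        ultimately show ?thesis
          using d(2)[OF that x(1)] x aE by (simp add: dual_diff abs_minus_commute)
      qed
      then obtain y where y: "y \<in> Y" "\<And>\<phi>. \<phi> \<in> \<Phi> \<Longrightarrow> \<bar>\<phi> (x \<ominus> a) - \<phi> y\<bar> < e"
        using \<Psi>(4) x aE by (metis M.minus_closed)
      have yE: "y \<in> carrier E" using y Y_carrier by blast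
      have "\<bar>\<phi> (x \<ominus> y) - \<phi> a\<bar> < e" if "\<phi> \<in> \<Phi>" for \<phi>
        using y(2)[OF that] \<Phi>(2) that x aE yE by (auto simp: dual_diff algebra_simps)
      then have "x \<ominus> y \<in> W" using \<Phi>(4) x yE by auto
      moreover have "q (x \<ominus> y) = B"
        using q_add_Y[of x "\<ominus> y"] submoduleE(3)[OF Y_submodule y(1)] x yE
        by (simp add: a_minus_def M.a_comm)
      ultimately show "B \<in> q ` W" by blast
    qed
    ultimately show "\<exists>T. openin (weak_topology Q) T \<and> A \<in> T \<and> T \<subseteq> q ` W" by blast
  qed
qed

end

section \<open>The Banach space of absolutely summable families\<close>

definition ell1 :: "('i \<Rightarrow> real) normed_module" where
  "ell1 = \<lparr>carrier = {x. (\<lambda>i. \<bar>x i\<bar>) summable_on UNIV}, mult = undefined, one = undefined,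
    zero = (\<lambda>i. 0), add = (\<lambda>x y i. x i + y i), smult = (\<lambda>c x i. c * x i),
    vnorm = (\<lambda>x. \<Sum>\<^sub>\<infinity>i. \<bar>x i\<bar>)\<rparr>"

lemma ell1_simps [simp]:
  "\<zero>\<^bsub>ell1\<^esub> = (\<lambda>i. 0)" "x \<oplus>\<^bsub>ell1\<^esub> y = (\<lambda>i. x i + y i)" "c \<odot>\<^bsub>ell1\<^esub> x = (\<lambda>i. c * x i)"
  unfolding ell1_def by simp_all

lemma carrier_ell1: "x \<in> carrier ell1 \<longleftrightarrow> (\<lambda>i. \<bar>x i\<bar>) summable_on UNIV"
  unfolding ell1_def by simp

lemma norm_ell1: "vnorm ell1 x = (\<Sum>\<^sub>\<infinity>i. \<bar>x i\<bar>)"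
  unfolding ell1_def by simp

lemma ell1_finite_sum_le: "x \<in> carrier ell1 \<Longrightarrow> finite F \<Longrightarrow> (\<Sum>i\<in>F. \<bar>x i\<bar>) \<le> vnorm ell1 x"
  unfolding norm_ell1 carrier_ell1 by (rule finite_sum_le_infsum) auto

text \<open>
  Membership in \<open>\<ell>\<^sub>1\<close> and norm bounds are read off finite partial sums; triangle inequality and
  completeness reduce to this.
\<close>

lemma ell1_bounded:
  assumes "\<And>F. finite F \<Longrightarrow> (\<Sum>i\<in>F. \<bar>x i\<bar>) \<le> B"
  shows "x \<in> carrier ell1" "vnorm ell1 x \<le> B"
proof -
  show x: "x \<in> carrier ell1"
    unfolding carrier_ell1
    by (rule nonneg_bdd_above_summable_on) (use assms in \<open>auto intro!: bdd_aboveI2[of _ _ B]\<close>)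
  then show "vnorm ell1 x \<le> B"
    unfolding norm_ell1 carrier_ell1 by (rule infsum_le_finite_sums) (use assms in auto)
qed

lemma ell1_sum_add_le:
  assumes "x \<in> carrier ell1" "y \<in> carrier ell1" "finite F"
  shows "(\<Sum>i\<in>F. \<bar>x i + y i\<bar>) \<le> vnorm ell1 x + vnorm ell1 y"
proof -
  have "(\<Sum>i\<in>F. \<bar>x i + y i\<bar>) \<le> (\<Sum>i\<in>F. \<bar>x i\<bar>) + (\<Sum>i\<in>F. \<bar>y i\<bar>)"
    unfolding sum.distrib[symmetric] by (rule sum_mono) auto
  then show ?thesis
    using ell1_finite_sum_le[OF assms(1,3)] ell1_finite_sum_le[OF assms(2,3)] by linarith
qed

lemma ell1_scale_closed: "x \<in> carrier ell1 \<Longrightarrow> (\<lambda>i. c * x i) \<in> carrier ell1"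
  unfolding carrier_ell1 abs_mult by (rule summable_on_cmult_right)

lemma ell1_uminus_closed: "x \<in> carrier ell1 \<Longrightarrow> (\<lambda>i. - x i) \<in> carrier ell1"
  unfolding carrier_ell1 by simp

lemma ell1_abelian_group: "abelian_group ell1"
proof (rule abelian_groupI)
  fix x y :: "'i \<Rightarrow> real" assume "x \<in> carrier ell1" "y \<in> carrier ell1"
  then show "x \<oplus>\<^bsub>ell1\<^esub> y \<in> carrier ell1"
    using ell1_bounded(1)[of "\<lambda>i. x i + y i", OF ell1_sum_add_le[of x y]] by simp
next
  fix x :: "'i \<Rightarrow> real" assume x: "x \<in> carrier ell1"
  then show "\<exists>y\<in>carrier ell1. y \<oplus>\<^bsub>ell1\<^esub> x = \<zero>\<^bsub>ell1\<^esub>"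
    by (intro bexI[of _ "\<lambda>i. - x i"]) (auto intro: ell1_uminus_closed)
qed (auto simp: carrier_ell1)

lemma cring_real_ring: "cring real_ring"
proof (rule cringI)
  show "abelian_group real_ring"
    by (rule abelian_groupI) (auto simp: real_ring_def intro!: exI[of _ "- x" for x])
  show "comm_monoid real_ring"
    by (rule comm_monoidI) (auto simp: real_ring_def)
qed (auto simp: real_ring_def algebra_simps)

lemma normed_space_ell1: "normed_space ell1"
  unfolding normed_space_def
proof (intro conjI ballI allI)
  show "module real_ring (ell1 :: ('i \<Rightarrow> real) normed_module)"
    by (rule moduleI[OF cring_real_ring ell1_abelian_group])
      (auto simp: real_ring_def algebra_simps ell1_scale_closed)
next
  fix x :: "'i \<Rightarrow> real" assume x: "x \<in> carrier ell1"
  show "0 \<le> vnorm ell1 x" unfolding norm_ell1 by (rule infsum_nonneg) simp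
  show "vnorm ell1 x = 0 \<longleftrightarrow> x = \<zero>\<^bsub>ell1\<^esub>"
  proof
    assume "vnorm ell1 x = 0"
    then have "\<bar>x i\<bar> \<le> 0" for i using ell1_finite_sum_le[OF x, of "{i}"] by simp
    then show "x = \<zero>\<^bsub>ell1\<^esub>" by (auto simp: fun_eq_iff)
  qed (simp add: norm_ell1)
  show "vnorm ell1 (c \<odot>\<^bsub>ell1\<^esub> x) = \<bar>c\<bar> * vnorm ell1 x" for c
    unfolding norm_ell1 by (simp add: abs_mult infsum_cmult_right')
  fix y :: "'i \<Rightarrow> real" assume y: "y \<in> carrier ell1"
  show "vnorm ell1 (x \<oplus>\<^bsub>ell1\<^esub> y) \<le> vnorm ell1 x + vnorm ell1 y"
    using ell1_bounded(2)[of "\<lambda>i. x i + y i", OF ell1_sum_add_le[OF x y]] by simp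
qed

interpretation ell1: real_normed_module ell1
  by standard (rule normed_space_ell1)

lemma ell1_diff [simp]:
  assumes "x \<in> carrier ell1" "y \<in> carrier ell1"
  shows "x \<ominus>\<^bsub>ell1\<^esub> y = (\<lambda>i. x i - y i)"
proof -
  have "\<ominus>\<^bsub>ell1\<^esub> y = (\<lambda>i. - y i)"
    using assms by (intro ell1.M.minus_equality) (auto intro: ell1_uminus_closed)
  then show ?thesis by (simp add: a_minus_def)
qed

lemma ell1_diff_closed:
  assumes "x \<in> carrier ell1" "y \<in> carrier ell1"
  shows "(\<lambda>i. x i - y i) \<in> carrier ell1"
  using ell1.M.minus_closed[OF assms] assms by simp

text \<open>
  A Cauchy sequence converges coordinatewise, and its bounds on finite partial sums pass to the
  coordinatewise limit.
\<close>

lemma banach_space_ell1: "banach_space ell1"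
  unfolding banach_space_def ell1.N.mcomplete_def
proof (intro conjI allI impI)
  fix \<sigma> :: "nat \<Rightarrow> 'i \<Rightarrow> real" assume "ell1.N.MCauchy \<sigma>"
  then have \<sigma>: "\<And>n. \<sigma> n \<in> carrier ell1"
    and Cauchy: "\<And>e. e > 0 \<Longrightarrow> \<exists>N. \<forall>m n. N \<le> m \<longrightarrow> N \<le> n \<longrightarrow> ndist ell1 (\<sigma> m) (\<sigma> n) < e"
    unfolding ell1.N.MCauchy_def by auto
  have sums: "\<exists>N. \<forall>m n F. N \<le> m \<longrightarrow> N \<le> n \<longrightarrow> finite F \<longrightarrow> (\<Sum>i\<in>F. \<bar>\<sigma> m i - \<sigma> n i\<bar>) < e"
    if e: "e > 0" for e
  proof -
    obtain N where N: "\<And>m n. N \<le> m \<Longrightarrow> N \<le> n \<Longrightarrow> ndist ell1 (\<sigma> m) (\<sigma> n) < e"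
      using Cauchy[OF e] by blast
    have "(\<Sum>i\<in>F. \<bar>\<sigma> m i - \<sigma> n i\<bar>) < e" if "N \<le> m" "N \<le> n" "finite F" for m n F
      using N[OF that(1,2)] ell1_finite_sum_le[OF ell1_diff_closed[OF \<sigma>[of m] \<sigma>[of n]] that(3)] \<sigma>
      by (simp add: ndist_def)
    then show ?thesis by blast
  qed
  have "convergent (\<lambda>n. \<sigma> n i)" for i
  proof -
    have "Cauchy (\<lambda>n. \<sigma> n i)"
    proof (rule metric_CauchyI)
      fix e :: real assume "e > 0"
      then obtain N where N: "\<And>m n F. N \<le> m \<Longrightarrow> N \<le> n \<Longrightarrow> finite F \<Longrightarrow> (\<Sum>i\<in>F. \<bar>\<sigma> m i - \<sigma> n i\<bar>) < e"
        using sums by blast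
      show "\<exists>M. \<forall>m\<ge>M. \<forall>n\<ge>M. dist (\<sigma> m i) (\<sigma> n i) < e"
        using N[of _ _ "{i}"] by (auto simp: dist_real_def)
    qed
    then show ?thesis by (simp add: Cauchy_convergent_iff)
  qed
  then obtain x where x: "\<And>i. (\<lambda>n. \<sigma> n i) \<longlonglongrightarrow> x i"
    unfolding convergent_def by metis
  have close: "\<exists>N. \<forall>n\<ge>N. (\<lambda>i. x i - \<sigma> n i) \<in> carrier ell1 \<and> vnorm ell1 (\<lambda>i. x i - \<sigma> n i) \<le> e"
    if e: "e > 0" for e
  proof -
    obtain N where N: "\<And>m n F. N \<le> m \<Longrightarrow> N \<le> n \<Longrightarrow> finite F \<Longrightarrow> (\<Sum>i\<in>F. \<bar>\<sigma> m i - \<sigma> n i\<bar>) < e"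
      using sums[OF e] by blast
    have "(\<Sum>i\<in>F. \<bar>x i - \<sigma> n i\<bar>) \<le> e" if "N \<le> n" "finite F" for n F
    proof (rule tendsto_upperbound)
      show "(\<lambda>m. \<Sum>i\<in>F. \<bar>\<sigma> m i - \<sigma> n i\<bar>) \<longlonglongrightarrow> (\<Sum>i\<in>F. \<bar>x i - \<sigma> n i\<bar>)"
        by (intro tendsto_intros x)
      show "\<forall>\<^sub>F m in sequentially. (\<Sum>i\<in>F. \<bar>\<sigma> m i - \<sigma> n i\<bar>) \<le> e"
        using N that by (intro eventually_sequentiallyI[of N]) (auto intro: less_imp_le)
    qed simp
    then have "(\<lambda>i. x i - \<sigma> n i) \<in> carrier ell1" "vnorm ell1 (\<lambda>i. x i - \<sigma> n i) \<le> e" if "N \<le> n" for n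
      using ell1_bounded[of "\<lambda>i. x i - \<sigma> n i" e] that by blast+
    then show ?thesis by blast
  qed
  have xE: "x \<in> carrier ell1"
  proof -
    obtain n where "(\<lambda>i. x i - \<sigma> n i) \<in> carrier ell1" using close[of 1] by auto
    from ell1.M.a_closed[OF this \<sigma>[of n]] show ?thesis by simp
  qed
  have "limitin ell1.N.mtopology \<sigma> x sequentially"
    unfolding ell1.N.limitin_metric
  proof (intro conjI allI impI)
    fix e :: real assume "e > 0"
    then obtain N where N: "\<And>n. N \<le> n \<Longrightarrow> vnorm ell1 (\<lambda>i. x i - \<sigma> n i) \<le> e / 2"
      using close[of "e / 2"] by auto
    have "ndist ell1 (\<sigma> n) x < e" if "N \<le> n" for n
    proof -
      have "ndist ell1 (\<sigma> n) x = vnorm ell1 (\<lambda>i. x i - \<sigma> n i)"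
        unfolding ell1.N.commute[of "\<sigma> n"] using \<sigma> xE by (simp add: ndist_def)
      then show ?thesis using N[OF that] \<open>e > 0\<close> by simp
    qed
    then show "\<forall>\<^sub>F n in sequentially. \<sigma> n \<in> carrier ell1 \<and> ndist ell1 (\<sigma> n) x < e"
      using \<sigma> by (intro eventually_sequentiallyI[of N]) auto
  qed (rule xE)
  then show "\<exists>x. limitin ell1.N.mtopology \<sigma> x sequentially" by blast
qed (rule normed_space_ell1)

text \<open>
  For bounded \<open>\<theta>\<close> this is the duality between \<open>\<ell>\<^sub>\<infinity>\<close> and \<open>\<ell>\<^sub>1\<close>.
\<close>

definition pairing :: "('i \<Rightarrow> real) \<Rightarrow> ('i \<Rightarrow> real) \<Rightarrow> real" where
  "pairing \<theta> x = (\<Sum>\<^sub>\<infinity>i. \<theta> i * x i)"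

lemma pairing_abs_summable:
  assumes "\<And>i. \<bar>\<theta> i\<bar> \<le> 1" "x \<in> carrier ell1"
  shows "(\<lambda>i. \<bar>\<theta> i * x i\<bar>) summable_on UNIV"
  using assms(2) unfolding carrier_ell1
  by (rule summable_on_comparison_test) (use assms(1) in \<open>auto simp: abs_mult mult_left_le_one_le\<close>)

lemma pairing_summable:
  assumes "\<And>i. \<bar>\<theta> i\<bar> \<le> 1" "x \<in> carrier ell1"
  shows "(\<lambda>i. \<theta> i * x i) summable_on UNIV"
  using pairing_abs_summable[OF assms] summable_on_iff_abs_summable_on_real by force

lemma pairing_dual:
  assumes \<theta>: "\<And>i. \<bar>\<theta> i\<bar> \<le> 1"
  shows "pairing \<theta> \<in> continuous_dual ell1"
proof (rule ell1.dualI[of _ 1])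
  fix x y :: "'a \<Rightarrow> real" assume "x \<in> carrier ell1" "y \<in> carrier ell1"
  then show "pairing \<theta> (x \<oplus>\<^bsub>ell1\<^esub> y) = pairing \<theta> x + pairing \<theta> y"
    unfolding pairing_def
    by (simp add: distrib_left infsum_add pairing_summable[OF \<theta>])
next
  fix c and x :: "'a \<Rightarrow> real"
  show "pairing \<theta> (c \<odot>\<^bsub>ell1\<^esub> x) = c * pairing \<theta> x"
    unfolding pairing_def by (simp add: mult.left_commute infsum_cmult_right')
next
  fix x :: "'a \<Rightarrow> real" assume x: "x \<in> carrier ell1"
  have "\<bar>pairing \<theta> x\<bar> \<le> (\<Sum>\<^sub>\<infinity>i. \<bar>\<theta> i * x i\<bar>)"
    using norm_infsum_bound[of "\<lambda>i. \<theta> i * x i" UNIV] pairing_abs_summable[OF \<theta> x]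
    unfolding pairing_def by simp
  also have "\<dots> \<le> vnorm ell1 x"
    unfolding norm_ell1 using pairing_abs_summable[OF \<theta> x] x unfolding carrier_ell1
    by (rule infsum_mono) (use \<theta> in \<open>auto simp: abs_mult mult_left_le_one_le\<close>)
  finally show "\<bar>pairing \<theta> x\<bar> \<le> 1 * vnorm ell1 x" by simp
qed

lemma coordinate_dual: "(\<lambda>x. x i) \<in> continuous_dual ell1"
proof (rule ell1.dualI[of _ 1])
  fix x :: "'a \<Rightarrow> real" assume x: "x \<in> carrier ell1"
  then show "\<bar>x i\<bar> \<le> 1 * vnorm ell1 x"
    using ell1_finite_sum_le[of x "{i}"] by simp
qed simp_all

lemma Hausdorff_weak_ell1: "Hausdorff_space (weak_topology ell1)"
proof (rule ell1.Hausdorff_weak)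
  fix x y :: "'a \<Rightarrow> real" assume "x \<noteq> y"
  then obtain i where "x i \<noteq> y i" by auto
  then show "\<exists>\<phi>\<in>continuous_dual ell1. \<phi> x \<noteq> \<phi> y"
    by (intro bexI[of _ "\<lambda>x. x i"] coordinate_dual)
qed

section \<open>The Schur property\<close>

text \<open>
  Choose alternately an index \<open>k\<close> so large that \<open>u k\<close> is small on the finite set \<open>F\<close> used so far, and
  an enlargement of \<open>F\<close> outside of which this \<open>u k\<close> is small. The chosen vectors are then concentrated
  on disjoint blocks, and \<open>\<theta>\<close> is, on each block, the sign of the corresponding vector.
\<close>

lemma gliding_hump:
  fixes u :: "nat \<Rightarrow> 'i \<Rightarrow> real"
  assumes u: "\<And>k. u k \<in> carrier ell1" and null: "\<And>i. (\<lambda>k. u k i) \<longlonglongrightarrow> 0"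
    and e: "e > 0" and big: "\<And>k. e \<le> vnorm ell1 (u k)"
  obtains r :: "nat \<Rightarrow> nat" and \<theta> where "strict_mono r" "\<And>i. \<bar>\<theta> i\<bar> \<le> 1" "\<And>j. e / 2 \<le> pairing \<theta> (u (r j))"
proof -
  have approx: "\<exists>F. finite F \<and> vnorm ell1 (u k) - (\<Sum>i\<in>F. \<bar>u k i\<bar>) \<le> e / 8" for k
  proof -
    obtain F where "finite F" "dist (\<Sum>i\<in>F. \<bar>u k i\<bar>) (vnorm ell1 (u k)) \<le> e / 8"
      using infsum_finite_approximation[of "\<lambda>i. \<bar>u k i\<bar>" UNIV "e / 8"] u[of k] e
      unfolding carrier_ell1 norm_ell1 by auto
    then show ?thesis by (intro exI[of _ F]) (unfold dist_real_def, linarith)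
  qed
  \<comment> \<open>a pair consists of the current index and the finite set that carries most of its vector\<close>
  define P where "P p \<longleftrightarrow> finite (snd p) \<and> vnorm ell1 (u (fst p)) - (\<Sum>i\<in>snd p. \<bar>u (fst p) i\<bar>) \<le> e / 8"
    for p :: "nat \<times> 'i set"
  define R where "R p p' \<longleftrightarrow> fst p < fst p' \<and> snd p \<subseteq> snd p' \<and> (\<Sum>i\<in>snd p. \<bar>u (fst p') i\<bar>) \<le> e / 8"
    for p p' :: "nat \<times> 'i set"
  have "\<exists>f. \<forall>n. P (f n) \<and> R (f n) (f (Suc n))"
  proof (rule dependent_nat_choice)
    show "\<exists>p. P p" using approx[of 0] unfolding P_def by auto
    fix p assume p: "P p"
    have "(\<lambda>k. \<Sum>i\<in>snd p. \<bar>u k i\<bar>) \<longlonglongrightarrow> (\<Sum>i\<in>snd p. \<bar>0\<bar>)"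
      by (intro tendsto_intros null)
    then have "(\<lambda>k. \<Sum>i\<in>snd p. \<bar>u k i\<bar>) \<longlonglongrightarrow> 0" by simp
    then have "eventually (\<lambda>k. (\<Sum>i\<in>snd p. \<bar>u k i\<bar>) < e / 8) sequentially"
      using e by (intro order_tendstoD) auto
    from eventually_happens[OF eventually_conj[OF this eventually_gt_at_top[of "fst p"]]]
    obtain k where k: "(\<Sum>i\<in>snd p. \<bar>u k i\<bar>) < e / 8" "fst p < k" by auto
    obtain F where F: "finite F" "vnorm ell1 (u k) - (\<Sum>i\<in>F. \<bar>u k i\<bar>) \<le> e / 8"
      using approx by blast
    have fin: "finite (snd p)" using p unfolding P_def by blast
    have "(\<Sum>i\<in>F. \<bar>u k i\<bar>) \<le> (\<Sum>i\<in>F \<union> snd p. \<bar>u k i\<bar>)"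
      using F fin by (intro sum_mono2) auto
    then show "\<exists>p'. P p' \<and> R p p'"
      using k F fin unfolding P_def R_def by (intro exI[of _ "(k, F \<union> snd p)"]) auto
  qed
  then obtain f where f: "\<And>n. P (f n)" "\<And>n. R (f n) (f (Suc n))" by blast
  define G where "G n = snd (f n)" for n
  define r where "r n = fst (f (Suc n))" for n
  have fin: "finite (G n)" for n using f(1)[of n] unfolding P_def G_def by blast
  have sub: "G m \<subseteq> G n" if "m \<le> n" for m n
    using that by (rule lift_Suc_mono_le[rotated]) (use f(2) in \<open>auto simp: R_def G_def\<close>)
  have head: "(\<Sum>i\<in>G n. \<bar>u (r n) i\<bar>) \<le> e / 8" for n
    using f(2)[of n] unfolding R_def G_def r_def by blast
  have tail: "vnorm ell1 (u (r n)) - (\<Sum>i\<in>G (Suc n). \<bar>u (r n) i\<bar>) \<le> e / 8" for n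
    using f(1)[of "Suc n"] unfolding P_def G_def r_def by blast
  define \<theta> where "\<theta> i = sgn (u (r (LEAST j. i \<in> G (Suc j))) i)" for i
  have \<theta>: "\<bar>\<theta> i\<bar> \<le> 1" for i unfolding \<theta>_def by (simp add: sgn_real_def)
  \<comment> \<open>the blocks \<open>G (Suc j) - G j\<close> are disjoint, so each of them has its own sign pattern\<close>
  have \<theta>_block: "\<theta> i = sgn (u (r j) i)" if ij: "i \<in> G (Suc j) - G j" for i j
  proof -
    have "(LEAST j. i \<in> G (Suc j)) = j"
    proof (rule Least_equality)
      show "j \<le> k" if "i \<in> G (Suc k)" for k
        using that ij sub[of "Suc k" j] by (meson DiffD2 not_less_eq_eq subsetD)
    qed (use ij in blast)
    then show ?thesis unfolding \<theta>_def by simp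
  qed
  have "e / 2 \<le> pairing \<theta> (u (r j))" for j
  proof -
    let ?v = "u (r j)"
    let ?D = "G (Suc j) - G j"
    have s: "(\<lambda>i. \<theta> i * ?v i) summable_on UNIV" by (rule pairing_summable[OF \<theta> u])
    \<comment> \<open>adding \<open>\<bar>?v i\<bar>\<close> makes all terms nonnegative, so the block alone bounds the series from below\<close>
    have "(\<Sum>i\<in>?D. 2 * \<bar>?v i\<bar>) = (\<Sum>i\<in>?D. \<theta> i * ?v i + \<bar>?v i\<bar>)"
      by (rule sum.cong[OF refl]) (simp add: \<theta>_block abs_sgn mult.commute)
    also have "\<dots> \<le> (\<Sum>\<^sub>\<infinity>i. \<theta> i * ?v i + \<bar>?v i\<bar>)"
    proof (rule finite_sum_le_infsum)
      show "(\<lambda>i. \<theta> i * ?v i + \<bar>?v i\<bar>) summable_on UNIV"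
        using s u[of "r j"] unfolding carrier_ell1 by (rule summable_on_add)
      fix i
      have "\<bar>\<theta> i * ?v i\<bar> \<le> \<bar>?v i\<bar>" using \<theta>[of i] by (simp add: abs_mult mult_left_le_one_le)
      then show "0 \<le> \<theta> i * ?v i + \<bar>?v i\<bar>" by linarith
    qed (use fin in auto)
    also have "\<dots> = pairing \<theta> ?v + vnorm ell1 ?v"
      unfolding pairing_def norm_ell1 using u[of "r j"] unfolding carrier_ell1 by (rule infsum_add[OF s])
    finally have "2 * (\<Sum>i\<in>?D. \<bar>?v i\<bar>) \<le> pairing \<theta> ?v + vnorm ell1 ?v"
      by (simp add: sum_distrib_left)
    moreover have "(\<Sum>i\<in>?D. \<bar>?v i\<bar>) = (\<Sum>i\<in>G (Suc j). \<bar>?v i\<bar>) - (\<Sum>i\<in>G j. \<bar>?v i\<bar>)"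
      by (rule sum_diff[OF fin sub]) simp
    ultimately show ?thesis using head[of j] tail[of j] big[of "r j"] by linarith
  qed
  moreover have "strict_mono r"
    unfolding strict_mono_Suc_iff r_def using f(2) by (auto simp: R_def)
  ultimately show ?thesis using that \<theta> by blast
qed

lemma accumulation_point_exists:
  assumes C: "compactin Z C" and x: "range x \<subseteq> C"
  obtains p where "p \<in> C" "accumulation_point Z x p"
proof -
  have "\<exists>p\<in>C. accumulation_point Z x p"
  proof (rule ccontr)
    assume "\<not> ?thesis"
    then have "\<forall>p\<in>C. \<exists>U. openin Z U \<and> p \<in> U \<and> finite {n. x n \<in> U}"
      using compactin_subset_topspace[OF C] unfolding accumulation_point_def by blast
    then obtain U where U: "\<And>p. p \<in> C \<Longrightarrow> openin Z (U p) \<and> p \<in> U p \<and> finite {n. x n \<in> U p}"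
      by metis
    then have "\<forall>W\<in>U ` C. openin Z W" "C \<subseteq> \<Union> (U ` C)" by auto
    then obtain \<F> where \<F>: "finite \<F>" "\<F> \<subseteq> U ` C" "C \<subseteq> \<Union> \<F>"
      using C unfolding compactin_def by meson
    have "UNIV = (\<Union>W\<in>\<F>. {n. x n \<in> W})" using \<F>(3) x by auto
    moreover have "finite (\<Union>W\<in>\<F>. {n. x n \<in> W})"
      using \<F>(1,2) U by (intro finite_UN_I) auto
    ultimately show False using infinite_UNIV_nat by metis
  qed
  then show ?thesis using that by blast
qed

lemma accumulation_point_closed:
  assumes p: "accumulation_point Z x p" and \<phi>: "continuous_map Z euclideanreal \<phi>"
    and S: "closed S" and ev: "eventually (\<lambda>n. \<phi> (x n) \<in> S) sequentially"
  shows "\<phi> p \<in> S"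
proof (rule ccontr)
  assume "\<phi> p \<notin> S"
  moreover have "openin Z {z \<in> topspace Z. \<phi> z \<in> - S}"
    by (rule openin_continuous_map_preimage[OF \<phi>]) (use S in auto)
  ultimately have "infinite {n. x n \<in> {z \<in> topspace Z. \<phi> z \<in> - S}}"
    using p unfolding accumulation_point_def by blast
  moreover obtain N where "\<And>n. N \<le> n \<Longrightarrow> \<phi> (x n) \<in> S"
    using ev unfolding eventually_sequentially by blast
  then have "{n. x n \<in> {z \<in> topspace Z. \<phi> z \<in> - S}} \<subseteq> {..<N}"
    by (auto simp: not_le[symmetric])
  ultimately show False using finite_subset by blast
qed

lemma accumulation_point_tendsto:
  assumes p: "accumulation_point Z x p" and \<phi>: "continuous_map Z euclideanreal \<phi>"
    and lim: "(\<lambda>n. \<phi> (x n)) \<longlonglongrightarrow> l"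
  shows "\<phi> p = l"
proof -
  have "\<phi> p \<in> cball l e" if "e > 0" for e
    using p \<phi>
  proof (rule accumulation_point_closed)
    show "eventually (\<lambda>n. \<phi> (x n) \<in> cball l e) sequentially"
      using tendstoD[OF lim that] by eventually_elim (simp add: dist_commute)
  qed simp
  then have "dist (\<phi> p) l \<le> 0 + e" if "e > 0" for e using that by (simp add: dist_commute)
  then have "dist (\<phi> p) l \<le> 0" by (rule field_le_epsilon)
  then show ?thesis by simp
qed

text \<open>
  Otherwise a subsequence keeps norm distance \<open>e\<close> from \<open>y\<close>, and the gliding hump for the differences gives
  a functional with values at least \<open>e / 2\<close> on a further subsequence of them. A weak accumulation
  point of the latter exists by compactness and equals \<open>y\<close> by its coordinates, a contradiction.
\<close>

lemma weakly_compact_coordinatewise_limit: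
  fixes x :: "nat \<Rightarrow> 'i \<Rightarrow> real"
  assumes C: "compactin (weak_topology ell1) C" and x: "range x \<subseteq> C"
    and y: "y \<in> carrier ell1" and lim: "\<And>i. (\<lambda>n. x n i) \<longlonglongrightarrow> y i"
  shows "limitin (norm_topology ell1) x y sequentially"
proof -
  have CE: "C \<subseteq> carrier ell1"
    using compactin_subset_topspace[OF C] by simp
  have xE: "x n \<in> carrier ell1" for n using x CE by auto
  show ?thesis
  proof (rule ccontr)
    assume "\<not> ?thesis"
    then obtain e where e: "e > 0" "\<not> eventually (\<lambda>n. ndist ell1 (x n) y < e) sequentially"
      unfolding norm_topology_def ell1.N.limitin_metric using xE y by auto
    then have "infinite {n. e \<le> ndist ell1 (x n) y}"
      unfolding not_eventually frequently_cofinite[symmetric] cofinite_eq_sequentially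
      by (simp add: not_less)
    then obtain t :: "nat \<Rightarrow> nat" where t: "strict_mono t" "\<And>k. e \<le> ndist ell1 (x (t k)) y"
      using infinite_enumerate by blast
    define u where "u k = (\<lambda>i. x (t k) i - y i)" for k
    have u: "u k \<in> carrier ell1" "e \<le> vnorm ell1 (u k)" for k
      using ell1_diff_closed[OF xE y] t(2)[of k] xE y unfolding u_def by (auto simp: ndist_def)
    have null: "(\<lambda>k. u k i) \<longlonglongrightarrow> 0" for i
      unfolding u_def
      using LIMSEQ_subseq_LIMSEQ[OF lim[of i] t(1)] by (simp add: o_def LIM_zero)
    obtain r :: "nat \<Rightarrow> nat" and \<theta> where r: "strict_mono r" and \<theta>: "\<And>i. \<bar>\<theta> i\<bar> \<le> 1"
      and hump: "\<And>j. e / 2 \<le> pairing \<theta> (u (r j))"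
      using gliding_hump[of u e, OF u(1) null e(1) u(2)] by metis
    define z where "z j = x (t (r j))" for j
    have zC: "range z \<subseteq> C" using x unfolding z_def by auto
    obtain p where p: "p \<in> C" "accumulation_point (weak_topology ell1) z p"
      by (rule accumulation_point_exists[OF C zC])
    have "p i = y i" for i
    proof (rule accumulation_point_tendsto[OF p(2) ell1.continuous_map_weak_dual[OF coordinate_dual]])
      show "(\<lambda>n. z n i) \<longlonglongrightarrow> y i"
        using LIMSEQ_subseq_LIMSEQ[OF lim[of i] strict_mono_o[OF t(1) r]] by (simp add: o_def z_def)
    qed
    then have "p = y" by auto
    have "pairing \<theta> p \<in> {pairing \<theta> y + e / 2..}"
    proof (rule accumulation_point_closed[OF p(2) ell1.continuous_map_weak_dual[OF pairing_dual[OF \<theta>]]])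
      have "pairing \<theta> y + e / 2 \<le> pairing \<theta> (z j)" for j
        using ell1.dual_diff[OF pairing_dual[OF \<theta>] xE[of "t (r j)"] y] xE y hump[of j]
        by (simp add: u_def z_def)
      then show "\<forall>\<^sub>F n in sequentially. pairing \<theta> (z n) \<in> {pairing \<theta> y + e / 2..}"
        by simp
    qed simp
    then show False using \<open>p = y\<close> e(1) by simp
  qed
qed

lemma ell1_schur:
  assumes lim: "limitin (weak_topology ell1) x y sequentially" and x: "range x \<subseteq> carrier ell1"
  shows "limitin (norm_topology ell1) x y sequentially"
proof (rule weakly_compact_coordinatewise_limit)
  show "compactin (weak_topology ell1) (insert y (range x))"
    by (rule compactin_sequence_with_limit[OF lim]) (use x in auto)
  show "y \<in> carrier ell1" using limitin_topspace[OF lim] by simp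
  show "(\<lambda>n. x n i) \<longlonglongrightarrow> y i" for i
    using continuous_map_limit[OF ell1.continuous_map_weak_dual[OF coordinate_dual] lim, of i]
    by (simp add: o_def)
qed auto

text \<open>
  All vectors involved live on a countable set of coordinates, so a diagonal choice among the
  neighbourhoods of \<open>y\<close> given by finitely many coordinates suffices.
\<close>

lemma ell1_coordinatewise_subsequence:
  fixes x :: "nat \<Rightarrow> 'i \<Rightarrow> real"
  assumes x: "range x \<subseteq> carrier ell1" and p: "accumulation_point (weak_topology ell1) x y"
  obtains r :: "nat \<Rightarrow> nat" where "strict_mono r" "\<And>i. (\<lambda>n. x (r n) i) \<longlonglongrightarrow> y i"
proof -
  have y: "y \<in> carrier ell1" using p unfolding accumulation_point_def by simp
  \<comment> \<open>the additional point only makes \<open>S\<close> nonempty, hence the range of a sequence\<close>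
  define S where "S = insert undefined ({i. y i \<noteq> 0} \<union> (\<Union>n. {i. x n i \<noteq> 0}))"
  have "countable {i. z i \<noteq> 0}" if "z \<in> carrier ell1" for z :: "'i \<Rightarrow> real"
    using abs_summable_countable[of z UNIV] that unfolding carrier_ell1 by simp
  then have "countable S" unfolding S_def using x y by auto
  then obtain s :: "nat \<Rightarrow> 'i" where s: "range s = S"
    using uncountable_def[of S] unfolding S_def by blast
  define W where "W k = carrier ell1 \<inter> (\<Inter>j\<in>{..k}. {z \<in> carrier ell1. z (s j) \<in> ball (y (s j)) (inverse (Suc k))})"
    for k
  have "infinite {n. x n \<in> W k}" for k
  proof -
    have "openin (weak_topology ell1) (W k)"
      unfolding W_def
      using openin_topspace[of "weak_topology ell1"]
      by (intro openin_Int openin_INT2 ell1.openin_weak_preimage[OF coordinate_dual]) auto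
    moreover have "y \<in> W k" using y unfolding W_def by simp
    ultimately show ?thesis using p unfolding accumulation_point_def by blast
  qed
  then have "\<exists>n>m. x n \<in> W k" for m k
    unfolding infinite_nat_iff_unbounded by blast
  then have "\<exists>r. \<forall>k. x (r k) \<in> W k \<and> r k < r (Suc k)"
    by (intro dependent_nat_choice) blast+
  then obtain r where r: "\<And>k. x (r k) \<in> W k" "\<And>k. r k < r (Suc k)" by blast
  have "(\<lambda>n. x (r n) i) \<longlonglongrightarrow> y i" for i
  proof (cases "i \<in> S")
    case True
    then obtain j where j: "i = s j" using s by blast
    show ?thesis
    proof (rule tendsto_dist_iff[THEN iffD2], rule tendsto_sandwich[of "\<lambda>n. 0" _ _ "\<lambda>n. inverse (Suc n)"])
      have "dist (x (r n) i) (y i) \<le> inverse (Suc n)" if "j \<le> n" for n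
        using r(1)[of n] that unfolding W_def j by (auto simp: dist_commute intro: less_imp_le)
      then show "\<forall>\<^sub>F n in sequentially. dist (x (r n) i) (y i) \<le> inverse (Suc n)"
        by (rule eventually_sequentiallyI)
    qed (use LIMSEQ_inverse_real_of_nat in auto)
  next
    case False
    then show ?thesis unfolding S_def by simp
  qed
  then show ?thesis using that r(2) unfolding strict_mono_Suc_iff by blast
qed

text \<open>
  Norm compactness is checked on sequences: weak compactness provides an accumulation point, which
  is a coordinatewise limit, and therefore the norm limit, of a subsequence.
\<close>

theorem ell1_weakly_compact_imp_compact:
  assumes C: "compactin (weak_topology ell1) C"
  shows "compactin (norm_topology ell1) C"
  unfolding norm_topology_def ell1.N.compactin_sequentially
proof (intro conjI allI impI)
  show CE: "C \<subseteq> carrier ell1"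
    using compactin_subset_topspace[OF C] by simp
  fix x :: "nat \<Rightarrow> 'a \<Rightarrow> real" assume x: "range x \<subseteq> C"
  obtain y where y: "y \<in> C" "accumulation_point (weak_topology ell1) x y"
    by (rule accumulation_point_exists[OF C x])
  obtain r :: "nat \<Rightarrow> nat" where r: "strict_mono r" "\<And>i. (\<lambda>n. x (r n) i) \<longlonglongrightarrow> y i"
    by (rule ell1_coordinatewise_subsequence[OF _ y(2)]) (use x CE in auto)
  have "limitin (norm_topology ell1) (x \<circ> r) y sequentially"
    by (rule weakly_compact_coordinatewise_limit[OF C]) (use x y CE r in auto)
  then show "\<exists>l r. l \<in> C \<and> strict_mono r \<and> limitin ell1.N.mtopology (x \<circ> r) l sequentially"
    using y r unfolding norm_topology_def by blast
qed

section \<open>Implications between the generalized metrizability properties\<close>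

lemma range_precompactin:
  assumes Z: "Hausdorff_space Z" and z: "convergentin Z z"
  shows "precompactin Z (range z)"
proof -
  obtain l where l: "limitin Z z l sequentially" and zZ: "range z \<subseteq> topspace Z"
    using z unfolding convergentin_def by blast
  have C: "compactin Z (insert l (range z))"
    by (rule compactin_sequence_with_limit[OF l subset_refl zZ])
  have "Z closure_of (range z) \<subseteq> insert l (range z)"
    by (rule closure_of_minimal[OF _ compactin_imp_closedin[OF Z C]]) blast
  then show ?thesis
    using zZ closed_compactin[OF C] unfolding precompactin_def by simp
qed

lemma k_imp_k_star_metrizable:
  assumes "k_metrizable Z"
  shows "k_star_metrizable Z"
proof -
  obtain M :: "(nat \<Rightarrow> 'a) topology" and f where
    M: "metrizable_space M" "k_proper_map M Z f" "f ` topspace M = topspace Z"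
    using assms unfolding k_metrizable_def by blast
  then have "subproper_map M Z f"
    unfolding k_proper_map_def subproper_map_def by blast
  then show ?thesis using M unfolding k_star_metrizable_def by blast
qed

text \<open>
  A section with values in the set \<open>D\<close> on which the map is proper sends a convergent sequence, which
  has precompact range, into a precompact set.
\<close>

lemma k_star_imp_cs_star_metrizable:
  assumes Z: "Hausdorff_space Z" and "k_star_metrizable Z"
  shows "cs_star_metrizable Z"
proof -
  obtain M :: "(nat \<Rightarrow> 'a) topology" and f where
    M: "metrizable_space M" "subproper_map M Z f" "f ` topspace M = topspace Z"
    using assms unfolding k_star_metrizable_def by blast
  then obtain D where f: "continuous_map M Z f" and D: "D \<subseteq> topspace M" "f ` D = topspace Z"
    "\<And>K. precompactin Z K \<Longrightarrow> precompactin M {x \<in> D. f x \<in> K}"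
    unfolding subproper_map_def by blast
  obtain s where s: "section_of M Z f s" "s ` topspace Z \<subseteq> D"
    by (rule section_exists[OF D(1,2)])
  have "cs_star_continuous Z M s"
    unfolding cs_star_continuous_def
  proof (intro allI impI)
    fix z assume z: "convergentin Z z"
    define L where "L = {x \<in> D. f x \<in> range z}"
    have L: "precompactin M L" unfolding L_def by (rule D(3)[OF range_precompactin[OF Z z]])
    have zZ: "z n \<in> topspace Z" for n using z unfolding convergentin_def by auto
    then have "range (s \<circ> z) \<subseteq> L"
      using s unfolding L_def section_of_def by auto
    then have "range (s \<circ> z) \<subseteq> M closure_of L"
      using closure_of_subset[of L M] L unfolding precompactin_def by blast
    moreover have "compactin M (M closure_of L)" using L unfolding precompactin_def by blast
    ultimately show "\<exists>p. accumulation_point M (s \<circ> z) p"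
      using accumulation_point_exists by metis
  qed
  then show ?thesis using M f s unfolding cs_star_metrizable_def by blast
qed

lemma cs_imp_cs_star_metrizable:
  assumes "cs_metrizable Z"
  shows "cs_star_metrizable Z"
proof -
  obtain M :: "(nat \<Rightarrow> 'a) topology" and f s where
    M: "metrizable_space M" "continuous_map M Z f" "f ` topspace M = topspace Z"
      "section_of M Z f s" "seq_continuous Z M s"
    using assms unfolding cs_metrizable_def by blast
  have "cs_star_continuous Z M s"
    unfolding cs_star_continuous_def
  proof (intro allI impI)
    fix z assume "convergentin Z z"
    then obtain p where p: "limitin M (s \<circ> z) p sequentially"
      using M(5) unfolding seq_continuous_def convergentin_def by blast
    have "infinite {n. (s \<circ> z) n \<in> U}" if "openin M U" "p \<in> U" for U
    proof -
      have "eventually (\<lambda>n. (s \<circ> z) n \<in> U) sequentially"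
        using p that unfolding limitin_def by blast
      then have "frequently (\<lambda>n. (s \<circ> z) n \<in> U) sequentially"
        by (simp add: eventually_frequently)
      then show ?thesis
        unfolding cofinite_eq_sequentially[symmetric] frequently_cofinite .
    qed
    then show "\<exists>p. accumulation_point M (s \<circ> z) p"
      using limitin_topspace[OF p] unfolding accumulation_point_def by blast
  qed
  then show ?thesis using M unfolding cs_star_metrizable_def by blast
qed

section \<open>An obstruction to cs*-metrizability\<close>

text \<open>
  By continuity of \<open>f\<close>, each value \<open>s (A i)\<close> has distance at least \<open>1 / (n i + 1)\<close> from all the others,
  for some \<open>n i\<close>. As there are uncountably many \<open>i\<close>, some number \<open>m\<close> occurs infinitely often as \<open>n i\<close>;
  a sequence of such indices is mapped by the section to a uniformly separated sequence, which has no
  accumulation point.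
\<close>

lemma uncountable_convergent_family_not_cs_star_metrizable:
  fixes A :: "'i \<Rightarrow> 'z"
  assumes unc: "uncountable (UNIV :: 'i set)"
    and conv: "\<And>\<sigma> :: nat \<Rightarrow> 'i. inj \<sigma> \<Longrightarrow> convergentin Z (A \<circ> \<sigma>)"
    and isolated: "\<And>i. \<exists>V. openin Z V \<and> A i \<in> V \<and> (\<forall>j. j \<noteq> i \<longrightarrow> A j \<notin> V)"
  shows "\<not> cs_star_metrizable Z"
proof
  assume "cs_star_metrizable Z"
  then obtain M :: "(nat \<Rightarrow> 'z) topology" and f s where
    M: "metrizable_space M" and f: "continuous_map M Z f"
    and s: "section_of M Z f s" and cs: "cs_star_continuous Z M s"
    unfolding cs_star_metrizable_def by blast
  obtain S d where "Metric_space S d" and Md: "M = Metric_space.mtopology S d"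
    using M unfolding metrizable_space_def by blast
  then interpret Metric_space S d by blast
  define T where "T i = s (A i)" for i
  have AZ: "A i \<in> topspace Z" for i
    using isolated[of i] openin_subset by blast
  have T: "T i \<in> S" "f (T i) = A i" for i
    using s AZ[of i] Md unfolding section_of_def T_def by auto
  have "\<exists>n. \<forall>j. j \<noteq> i \<longrightarrow> inverse (real (Suc n)) \<le> d (T i) (T j)" for i
  proof -
    obtain V where V: "openin Z V" "A i \<in> V" "\<And>j. j \<noteq> i \<Longrightarrow> A j \<notin> V"
      using isolated[of i] by blast
    have "openin mtopology {x \<in> topspace M. f x \<in> V}"
      using openin_continuous_map_preimage[OF f V(1)] unfolding Md .
    moreover have "T i \<in> {x \<in> topspace M. f x \<in> V}" using T V(2) Md by simp
    ultimately obtain r where r: "r > 0" "mball (T i) r \<subseteq> {x \<in> topspace M. f x \<in> V}"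
      unfolding openin_mtopology by blast
    obtain n where n: "inverse (real (Suc n)) < r" using reals_Archimedean[OF r(1)] by blast
    have "inverse (real (Suc n)) \<le> d (T i) (T j)" if "j \<noteq> i" for j
    proof (rule ccontr)
      assume "\<not> ?thesis"
      then have "T j \<in> mball (T i) r" using T n by simp
      then show False using r(2) V(3)[OF that] T(2) by auto
    qed
    then show ?thesis by blast
  qed
  then obtain n where n: "\<And>i j. j \<noteq> i \<Longrightarrow> inverse (real (Suc (n i))) \<le> d (T i) (T j)"
    by metis
  obtain m where m: "infinite {i. n i = m}"
  proof (rule ccontr)
    assume "\<not> thesis"
    then have "countable (\<Union>m. {i. n i = m})"
      using that by (intro countable_UN) (auto intro: countable_finite)
    moreover have "(\<Union>m. {i. n i = m}) = UNIV" by auto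
    ultimately show False using unc by simp
  qed
  obtain \<sigma> :: "nat \<Rightarrow> 'i" where \<sigma>: "inj \<sigma>" "range \<sigma> \<subseteq> {i. n i = m}"
    using infinite_countable_subset[OF m] by blast
  obtain p where p: "accumulation_point M (s \<circ> (A \<circ> \<sigma>)) p"
    using cs conv[OF \<sigma>(1)] unfolding cs_star_continuous_def by blast
  define e where "e = inverse (real (Suc m))"
  have pS: "p \<in> S" using p Md unfolding accumulation_point_def by simp
  have "openin M (mball p (e / 2))" "p \<in> mball p (e / 2)"
    using pS unfolding Md e_def by (simp_all del: of_nat_Suc)
  then have "infinite {k. (s \<circ> (A \<circ> \<sigma>)) k \<in> mball p (e / 2)}"
    using p unfolding accumulation_point_def by blast
  then have "\<exists>k>l. T (\<sigma> k) \<in> mball p (e / 2)" for l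
    unfolding infinite_nat_iff_unbounded T_def by auto
  then obtain a b where ab: "a < b" "T (\<sigma> a) \<in> mball p (e / 2)" "T (\<sigma> b) \<in> mball p (e / 2)"
    by meson
  have "\<sigma> b \<noteq> \<sigma> a" using \<sigma>(1) ab(1) by (auto dest: injD)
  moreover have "n (\<sigma> a) = m" using \<sigma>(2) by blast
  ultimately have "e \<le> d (T (\<sigma> a)) (T (\<sigma> b))"
    using n[of "\<sigma> b" "\<sigma> a"] unfolding e_def by simp
  moreover have "d (T (\<sigma> a)) (T (\<sigma> b)) \<le> d p (T (\<sigma> a)) + d p (T (\<sigma> b))"
    using triangle''[of p "T (\<sigma> a)" "T (\<sigma> b)"] T pS triangle commute by metis
  ultimately show False using ab by simp
qed

section \<open>The weak topology of the space is k- and cs-metrizable\<close>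

text \<open>
  The weak closure of a weakly precompact set is norm compact, and it contains the norm closure.
\<close>

lemma k_proper_map_ell1: "k_proper_map (norm_topology ell1) (weak_topology ell1) id"
  unfolding k_proper_map_def
proof (intro conjI allI impI)
  show "continuous_map (norm_topology ell1) (weak_topology ell1) id"
    by (rule ell1.continuous_map_norm_weak)
  fix K :: "('a \<Rightarrow> real) set" assume K: "precompactin (weak_topology ell1) K"
  let ?C = "weak_topology ell1 closure_of K"
  have KE: "K \<subseteq> carrier ell1" and "compactin (weak_topology ell1) ?C"
    using K unfolding precompactin_def by auto
  then have C: "compactin (norm_topology ell1) ?C"
    by (intro ell1_weakly_compact_imp_compact)
  have "closedin (norm_topology ell1) ?C"
    using ell1.N.Hausdorff_space_mtopology C
    unfolding norm_topology_def by (rule compactin_imp_closedin)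
  then have "norm_topology ell1 closure_of K \<subseteq> ?C"
    using KE by (intro closure_of_minimal closure_of_subset) auto
  then have "compactin (norm_topology ell1) (norm_topology ell1 closure_of K)"
    using closed_compactin[OF C] by simp
  moreover have "{x \<in> topspace (norm_topology ell1). id x \<in> K} = K" using KE by auto
  ultimately show "precompactin (norm_topology ell1) {x \<in> topspace (norm_topology ell1). id x \<in> K}"
    using KE unfolding precompactin_def by simp
qed

lemma metrizable_norm_ell1: "metrizable_space (norm_topology ell1)"
  unfolding norm_topology_def by (rule ell1.N.metrizable_space_mtopology)

lemma k_metrizable_weak_ell1: "k_metrizable (weak_topology ell1)"
  by (rule k_metrizableI[OF metrizable_norm_ell1 k_proper_map_ell1]) simp

lemma cs_metrizable_weak_ell1: "cs_metrizable (weak_topology ell1)"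
proof (rule cs_metrizableI[OF metrizable_norm_ell1 ell1.continuous_map_norm_weak])
  show "section_of (norm_topology ell1) (weak_topology ell1) id id"
    unfolding section_of_def by simp
  show "seq_continuous (weak_topology ell1) (norm_topology ell1) id"
    unfolding seq_continuous_def convergentin_def using ell1_schur by auto
qed simp

section \<open>A quotient with an uncountable weakly null family of isolated points\<close>

definition unit_vector :: "'i \<Rightarrow> 'i \<Rightarrow> real" where
  "unit_vector a = (\<lambda>b. if b = a then 1 else 0)"

lemma unit_vector_carrier: "unit_vector a \<in> carrier ell1"
  and unit_vector_norm: "vnorm ell1 (unit_vector a) \<le> 1"
proof -
  have "(\<Sum>b\<in>F. \<bar>unit_vector a b\<bar>) \<le> 1" if "finite F" for F
  proof -
    have "(\<Sum>b\<in>F. \<bar>unit_vector a b\<bar>) = (\<Sum>b\<in>F. if b = a then 1 else 0)"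
      unfolding unit_vector_def by (rule sum.cong) auto
    then show ?thesis using that by simp
  qed
  from ell1_bounded[OF this] show "unit_vector a \<in> carrier ell1" "vnorm ell1 (unit_vector a) \<le> 1"
    by blast+
qed

lemma pairing_unit_vector: "pairing \<theta> (unit_vector a) = \<theta> a"
proof -
  have "pairing \<theta> (unit_vector a) = (\<Sum>\<^sub>\<infinity>i\<in>{a}. \<theta> i * unit_vector a i)"
    unfolding pairing_def by (rule infsum_cong_neutral) (auto simp: unit_vector_def)
  then show ?thesis by (simp add: unit_vector_def)
qed

text \<open>
  The index type consists of functions, so that a function \<open>a\<close> is used as a code of the set
  \<open>{b. a b = 1}\<close>. Every subset of \<open>'b\<close> has a code, its indicator function.
\<close>

definition membership :: "'b \<Rightarrow> ('b \<Rightarrow> real) \<Rightarrow> real" where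
  "membership b a = (if a b = 1 then 1 else 0)"

lemma pairing_membership_dual: "pairing (membership b) \<in> continuous_dual ell1"
  by (rule pairing_dual) (simp add: membership_def)

definition membership_kernel :: "(('b \<Rightarrow> real) \<Rightarrow> real) set" where
  "membership_kernel = {x \<in> carrier ell1. \<forall>\<phi>\<in>range (\<lambda>b. pairing (membership b)). \<phi> x = 0}"

lemma closed_linear_subspace_membership_kernel: "closed_linear_subspace membership_kernel ell1"
  unfolding membership_kernel_def
  by (rule ell1.annihilator_closed_subspace) (auto intro: pairing_membership_dual)

interpretation quot: normed_quotient ell1 membership_kernel
  by standard (rule closed_linear_subspace_membership_kernel)

lemma membership_kernelI: "x \<in> carrier ell1 \<Longrightarrow> (\<And>b. pairing (membership b) x = 0) \<Longrightarrow> x \<in> membership_kernel"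
  unfolding membership_kernel_def by blast

lemma pairing_membership_descends:
  obtains \<phi> where "\<phi> \<in> continuous_dual (quotient_space ell1 membership_kernel)"
    "\<And>x. x \<in> carrier ell1 \<Longrightarrow> \<phi> (membership_kernel +>\<^bsub>ell1\<^esub> x) = pairing (membership b) x"
proof -
  have "pairing (membership b) y = 0" if "y \<in> membership_kernel" for y
    using that unfolding membership_kernel_def by auto
  from quot.dual_descends[OF pairing_membership_dual this] show ?thesis
    using that by blast
qed

lemma Hausdorff_weak_quotient: "Hausdorff_space (weak_topology (quotient_space ell1 membership_kernel))"
proof (rule quot.Q.Hausdorff_weak)
  fix A B assume "A \<in> carrier (quotient_space ell1 membership_kernel)" "B \<in> carrier (quotient_space ell1 membership_kernel)"
    and AB: "A \<noteq> B"
  then obtain x y where x: "x \<in> carrier ell1" "A = membership_kernel +>\<^bsub>ell1\<^esub> x"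
    and y: "y \<in> carrier ell1" "B = membership_kernel +>\<^bsub>ell1\<^esub> y"
    unfolding quot.carrier_Q by auto
  have "x \<ominus>\<^bsub>ell1\<^esub> y \<notin> membership_kernel"
  proof
    assume "x \<ominus>\<^bsub>ell1\<^esub> y \<in> membership_kernel"
    from quot.q_add_Y[OF y(1) this] show False using AB x y by simp
  qed
  then obtain b where "pairing (membership b) (x \<ominus>\<^bsub>ell1\<^esub> y) \<noteq> 0"
    using membership_kernelI[of "x \<ominus>\<^bsub>ell1\<^esub> y"] ell1.M.minus_closed[OF x(1) y(1)] by blast
  then have ne: "pairing (membership b) x \<noteq> pairing (membership b) y"
    using ell1.dual_diff[OF pairing_membership_dual x(1) y(1), of b] by linarith
  obtain \<phi> where \<phi>: "\<phi> \<in> continuous_dual (quotient_space ell1 membership_kernel)"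
    "\<And>x. x \<in> carrier ell1 \<Longrightarrow> \<phi> (membership_kernel +>\<^bsub>ell1\<^esub> x) = pairing (membership b) x"
    using pairing_membership_descends[of b] by blast
  then show "\<exists>\<phi>\<in>continuous_dual (quotient_space ell1 membership_kernel). \<phi> A \<noteq> \<phi> B"
    using ne x y by (intro bexI[of _ \<phi>]) auto
qed

definition set_vector :: "'b set \<Rightarrow> ('b \<Rightarrow> real) \<Rightarrow> real" where
  "set_vector F = unit_vector (indicator F)"

lemma pairing_set_vector: "pairing (membership b) (set_vector F) = indicator F b"
  unfolding set_vector_def pairing_unit_vector membership_def by (simp add: indicator_def)

lemma set_vector_carrier: "set_vector F \<in> carrier ell1"
  unfolding set_vector_def by (rule unit_vector_carrier)

text \<open>
  The functionals that define the kernel cannot distinguish the vector of a finite set from the sum of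
  the vectors of its elements.
\<close>

lemma functional_set_vector:
  assumes \<psi>: "\<psi> \<in> continuous_dual ell1" and Y: "\<And>y. y \<in> membership_kernel \<Longrightarrow> \<psi> y = 0" and "finite F"
  shows "\<psi> (set_vector F) = (\<Sum>b\<in>F. \<psi> (set_vector {b}))"
  using assms(3)
proof induction
  case empty
  have "set_vector {} \<in> membership_kernel"
    by (rule membership_kernelI[OF set_vector_carrier]) (simp add: pairing_set_vector)
  then show ?case using Y by simp
next
  case (insert c F)
  note cl = set_vector_carrier
  define y where "y = set_vector (insert c F) \<ominus>\<^bsub>ell1\<^esub> set_vector F \<ominus>\<^bsub>ell1\<^esub> set_vector {c}"
  have y: "\<phi> y = \<phi> (set_vector (insert c F)) - \<phi> (set_vector F) - \<phi> (set_vector {c})"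
    if "\<phi> \<in> continuous_dual ell1" for \<phi>
    unfolding y_def using ell1.dual_diff[OF that] ell1.M.minus_closed[OF cl cl] cl by metis
  have "y \<in> membership_kernel"
  proof (rule membership_kernelI)
    show "y \<in> carrier ell1" unfolding y_def by (intro ell1.M.minus_closed cl)
    show "pairing (membership b) y = 0" for b
      unfolding y[OF pairing_membership_dual] pairing_set_vector
      using insert.hyps by (simp add: indicator_def)
  qed
  then show ?case using y[OF \<psi>] Y insert by simp
qed

text \<open>
  Bounded finite sums, taken separately over the nonnegative and over the negative terms, give
  absolute summability.
\<close>

lemma bounded_sums_imp_null:
  fixes g :: "'b \<Rightarrow> real"
  assumes B: "\<And>F. finite F \<Longrightarrow> \<bar>\<Sum>b\<in>F. g b\<bar> \<le> B" and \<sigma>: "inj (\<sigma> :: nat \<Rightarrow> 'b)"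
  shows "(\<lambda>n. g (\<sigma> n)) \<longlonglongrightarrow> 0"
proof -
  have "(\<Sum>b\<in>F. \<bar>g b\<bar>) \<le> 2 * B" if F: "finite F" for F
  proof -
    have "(\<Sum>b\<in>F. \<bar>g b\<bar>) = (\<Sum>b\<in>{b\<in>F. 0 \<le> g b}. \<bar>g b\<bar>) + (\<Sum>b\<in>{b\<in>F. \<not> 0 \<le> g b}. \<bar>g b\<bar>)"
      using F by (subst sum.union_disjoint[symmetric]) (auto intro!: sum.cong)
    also have "\<dots> = (\<Sum>b\<in>{b\<in>F. 0 \<le> g b}. g b) - (\<Sum>b\<in>{b\<in>F. \<not> 0 \<le> g b}. g b)"
      by (simp add: sum_negf[symmetric] del: sum_negf)
    also have "\<dots> \<le> 2 * B"
      using B[of "{b\<in>F. 0 \<le> g b}"] B[of "{b\<in>F. \<not> 0 \<le> g b}"] F by simp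
    finally show ?thesis .
  qed
  moreover have "(\<Sum>n<N. \<bar>g (\<sigma> n)\<bar>) = (\<Sum>b\<in>\<sigma> ` {..<N}. \<bar>g b\<bar>)" for N
    using inj_on_subset[OF \<sigma> subset_UNIV] by (simp add: sum.reindex)
  ultimately have "(\<Sum>n<N. \<bar>g (\<sigma> n)\<bar>) \<le> 2 * B" for N by simp
  then have "summable (\<lambda>n. \<bar>g (\<sigma> n)\<bar>)"
    by (intro bounded_imp_summable[of _ "2 * B"]) (simp_all only: lessThan_Suc_atMost[symmetric] abs_ge_zero)
  then show ?thesis using summable_LIMSEQ_zero tendsto_rabs_zero_iff by blast
qed

text \<open>
  The classes of the vectors of singletons form the forbidden family. For a functional \<open>\<phi>\<close> the sum of its
  values over a finite set \<open>F\<close> is its value at the class of a single unit vector, so these sums are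
  bounded by the norm of \<open>\<phi>\<close> and injective sequences are weakly null.
\<close>

lemma quotient_not_cs_star_metrizable:
  assumes unc: "uncountable (UNIV :: 'b set)"
  shows "\<not> cs_star_metrizable (weak_topology (quotient_space ell1 (membership_kernel :: (('b \<Rightarrow> real) \<Rightarrow> real) set)))"
proof (rule uncountable_convergent_family_not_cs_star_metrizable[OF unc])
  let ?A = "\<lambda>b::'b. membership_kernel +>\<^bsub>ell1\<^esub> set_vector {b}"
  let ?Q = "quotient_space ell1 (membership_kernel :: (('b \<Rightarrow> real) \<Rightarrow> real) set)"
  have A: "?A b \<in> carrier ?Q" for b by (rule quot.q_closed[OF set_vector_carrier])
  {
    fix \<sigma> :: "nat \<Rightarrow> 'b" assume \<sigma>: "inj \<sigma>"
    have "limitin (weak_topology ?Q) (?A \<circ> \<sigma>) \<zero>\<^bsub>?Q\<^esub> sequentially"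
    proof (rule quot.Q.limitin_weak)
      show "range (?A \<circ> \<sigma>) \<subseteq> carrier ?Q" using A by auto
      fix \<phi> assume \<phi>: "\<phi> \<in> continuous_dual ?Q"
      let ?\<psi> = "\<lambda>x. \<phi> (membership_kernel +>\<^bsub>ell1\<^esub> x)"
      have \<psi>: "?\<psi> \<in> continuous_dual ell1" "\<And>y. y \<in> membership_kernel \<Longrightarrow> ?\<psi> y = 0"
        using quot.dual_pullback[OF \<phi>] quot.dual_pullback_Y[OF \<phi>] by auto
      obtain B where B: "B \<ge> 0" "\<And>x. x \<in> carrier ell1 \<Longrightarrow> \<bar>?\<psi> x\<bar> \<le> B * vnorm ell1 x"
        using ell1.dual_bounded[OF \<psi>(1)] by blast
      have "\<bar>\<Sum>b\<in>F. \<phi> (?A b)\<bar> \<le> B" if "finite F" for F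
      proof -
        have "\<bar>\<Sum>b\<in>F. \<phi> (?A b)\<bar> \<le> B * vnorm ell1 (set_vector F)"
          using functional_set_vector[OF \<psi> that] B(2)[OF set_vector_carrier[of F]] by simp
        also have "\<dots> \<le> B * 1"
          using B(1) unit_vector_norm unfolding set_vector_def by (intro mult_left_mono) auto
        finally show ?thesis by simp
      qed
      from bounded_sums_imp_null[OF this \<sigma>]
      show "(\<lambda>n. \<phi> ((?A \<circ> \<sigma>) n)) \<longlonglongrightarrow> \<phi> \<zero>\<^bsub>?Q\<^esub>"
        by (simp add: quot.Q.dual_zero[OF \<phi>])
    qed simp
    then show "convergentin (weak_topology ?Q) (?A \<circ> \<sigma>)"
      using A unfolding convergentin_def by auto
  }
  fix b :: 'b
  obtain \<phi> where \<phi>: "\<phi> \<in> continuous_dual ?Q"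
    "\<And>x. x \<in> carrier ell1 \<Longrightarrow> \<phi> (membership_kernel +>\<^bsub>ell1\<^esub> x) = pairing (membership b) x"
    using pairing_membership_descends[of b] by blast
  have val: "\<phi> (?A c) = indicator {c} b" for c
    unfolding \<phi>(2)[OF set_vector_carrier] pairing_set_vector ..
  show "\<exists>V. openin (weak_topology ?Q) V \<and> ?A b \<in> V \<and> (\<forall>c. c \<noteq> b \<longrightarrow> ?A c \<notin> V)"
    by (rule exI[of _ "{B \<in> carrier ?Q. \<phi> B \<in> {1/2<..}}"])
      (use A val quot.Q.openin_weak_preimage[OF \<phi>(1), of "{1/2<..}"] in \<open>auto simp: indicator_def\<close>)
qed

section \<open>The counterexample\<close>

theorem proposition12p5:
  shows "(\<exists>(X :: ((real \<Rightarrow> real) \<Rightarrow> real) normed_module) Y.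
            banach_space X \<and> closed_linear_subspace Y X \<and>
            Hausdorff_space (weak_topology X) \<and>
            Hausdorff_space (weak_topology (quotient_space X Y)) \<and>
            k_metrizable (weak_topology X) \<and>
            \<not> cs_star_metrizable (weak_topology (quotient_space X Y)))
       \<and> \<not> preserved_by_open_maps
             (k_metrizable :: ((real \<Rightarrow> real) \<Rightarrow> real) topology \<Rightarrow> bool)
             (k_metrizable :: ((real \<Rightarrow> real) \<Rightarrow> real) set topology \<Rightarrow> bool)
       \<and> \<not> preserved_by_open_maps
             (k_star_metrizable :: ((real \<Rightarrow> real) \<Rightarrow> real) topology \<Rightarrow> bool)
             (k_star_metrizable :: ((real \<Rightarrow> real) \<Rightarrow> real) set topology \<Rightarrow> bool)
       \<and> \<not> preserved_by_open_maps
             (cs_metrizable :: ((real \<Rightarrow> real) \<Rightarrow> real) topology \<Rightarrow> bool)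
             (cs_metrizable :: ((real \<Rightarrow> real) \<Rightarrow> real) set topology \<Rightarrow> bool)
       \<and> \<not> preserved_by_open_maps
             (cs_star_metrizable :: ((real \<Rightarrow> real) \<Rightarrow> real) topology \<Rightarrow> bool)
             (cs_star_metrizable :: ((real \<Rightarrow> real) \<Rightarrow> real) set topology \<Rightarrow> bool)"
proof -
  let ?X = "ell1 :: ((real \<Rightarrow> real) \<Rightarrow> real) normed_module"
  let ?Q = "quotient_space ?X membership_kernel"
  have not_cs_star: "\<not> cs_star_metrizable (weak_topology ?Q)"
    by (rule quotient_not_cs_star_metrizable[OF uncountable_UNIV_real])
  have not_preserved: "\<not> preserved_by_open_maps P R"
    if "P (weak_topology ?X)" "R (weak_topology ?Q) \<Longrightarrow> cs_star_metrizable (weak_topology ?Q)" for P R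
  proof
    assume "preserved_by_open_maps P R"
    moreover have "(\<lambda>x. membership_kernel +>\<^bsub>?X\<^esub> x) ` topspace (weak_topology ?X) = topspace (weak_topology ?Q)"
      by (simp add: quot.carrier_Q)
    ultimately have "R (weak_topology ?Q)"
      using that(1) Hausdorff_weak_ell1 Hausdorff_weak_quotient quot.continuous_map_q quot.open_map_q
      unfolding preserved_by_open_maps_def by blast
    then show False using that(2) not_cs_star by blast
  qed
  note k_star = k_imp_k_star_metrizable and cs_star = k_star_imp_cs_star_metrizable
  show ?thesis
  proof (intro conjI)
    show "\<exists>(X :: ((real \<Rightarrow> real) \<Rightarrow> real) normed_module) Y.
        banach_space X \<and> closed_linear_subspace Y X \<and>
        Hausdorff_space (weak_topology X) \<and> Hausdorff_space (weak_topology (quotient_space X Y)) \<and>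
        k_metrizable (weak_topology X) \<and> \<not> cs_star_metrizable (weak_topology (quotient_space X Y))"
      using banach_space_ell1 closed_linear_subspace_membership_kernel Hausdorff_weak_ell1
        Hausdorff_weak_quotient k_metrizable_weak_ell1 not_cs_star by blast
    show "\<not> preserved_by_open_maps
        (k_metrizable :: ((real \<Rightarrow> real) \<Rightarrow> real) topology \<Rightarrow> bool)
        (k_metrizable :: ((real \<Rightarrow> real) \<Rightarrow> real) set topology \<Rightarrow> bool)"
      by (rule not_preserved) (blast intro: k_metrizable_weak_ell1 cs_star[OF Hausdorff_weak_quotient k_star])+
    show "\<not> preserved_by_open_maps
        (k_star_metrizable :: ((real \<Rightarrow> real) \<Rightarrow> real) topology \<Rightarrow> bool)
        (k_star_metrizable :: ((real \<Rightarrow> real) \<Rightarrow> real) set topology \<Rightarrow> bool)"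
      by (rule not_preserved) (blast intro: k_star[OF k_metrizable_weak_ell1] cs_star[OF Hausdorff_weak_quotient])+
    show "\<not> preserved_by_open_maps
        (cs_metrizable :: ((real \<Rightarrow> real) \<Rightarrow> real) topology \<Rightarrow> bool)
        (cs_metrizable :: ((real \<Rightarrow> real) \<Rightarrow> real) set topology \<Rightarrow> bool)"
      by (rule not_preserved) (blast intro: cs_metrizable_weak_ell1 cs_imp_cs_star_metrizable)+
    show "\<not> preserved_by_open_maps
        (cs_star_metrizable :: ((real \<Rightarrow> real) \<Rightarrow> real) topology \<Rightarrow> bool)
        (cs_star_metrizable :: ((real \<Rightarrow> real) \<Rightarrow> real) set topology \<Rightarrow> bool)"
      by (rule not_preserved) (blast intro: cs_imp_cs_star_metrizable[OF cs_metrizable_weak_ell1])+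
  qed
qed

end
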